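(* Let $G=\mathrm{GL}_n(F)$, let $K=\mathrm{O}_n(F)=\{g\in G: g^Tg=1_n\}$, and let $B\subset G$ be the Iwahori subgroup. For each double coset $\mathcal{O}\in K\backslash G/B$ there exists a unique $w\in \mathsf{eSymAPM}_n$ such that $g^Tg=w$ for some $g\in\mathcal{O}$. Moreover, for each $w\in\mathsf{eSymAPM}_n$, the set of matrices $g\in G$ satisfying $g^Tg=w$ is non-empty and its elements all lie in the same double coset in $K\backslash G/B$.
   Context: $n$ is a positive integer. $\mathbb{K}$ is a quadratically closed field, i.e. a field of characteristic not equal to $2$ in which every element has a square root. $F=\mathbb{K}((t))$ is the field of formal Laurent series and $A=\mathbb{K}[[t]]$ the ring of formal power series over $\mathbb{K}$. $1_n$ is the $n\times n$ identity matrix. The Iwahori subgroup $B$ is the subgroup of $\mathrm{GL}_n(A)$ (matrices with entries in $A$ that are invertible over $A$) consisting of the matrices that become upper triangular upon setting $t=0$. A monomial matrix is a square matrix with exactly one non-zero entry in each row and each column. An affine permutation matrix is an $n\times n$ monomial matrix over $F$ whose non-zero entries are integral powers $t^a$ ($a\in\mathbb{Z}$, varying from entry to entry). $\mathsf{SymAPM}_n$ is the set of all symmetric $n\times n$ affine permutation matrices, and $\mathsf{eSymAPM}_n$ is the set of elements of $\mathsf{SymAPM}_n$ for which the sum of the exponents of $t$ over all $n$ non-zero entries is even. *)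

theory Defs
  imports
    "Jordan_Normal_Form.Matrix"
    "HOL-Algebra.Coset"
    "HOL-Computational_Algebra.Formal_Laurent_Series"
begin

definition quadratically_closed :: "'a::field itself \<Rightarrow> bool" where
  "quadratically_closed _ \<longleftrightarrow> CHAR('a) \<noteq> 2 \<and> (\<forall>x::'a. \<exists>y. y ^ 2 = x)"

definition GL :: "nat \<Rightarrow> 'r::comm_ring_1 mat monoid" where
  "GL n = units_of (ring_mat TYPE('r) n ())"

definition orthogonal_group :: "nat \<Rightarrow> 'r::comm_ring_1 mat set" where
  "orthogonal_group n = {g \<in> carrier (GL n). transpose_mat g * g = 1\<^sub>m n}"

text \<open>Power series over the field are embedded into Laurent series by \<^const>\<open>fps_to_fls\<close>, so
  \<open>GL n\<close> below is the general linear group over the ring of power series: the inverse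
  matrix also has entries in that ring.  Setting \<open>t = 0\<close> takes constant coefficients.\<close>
definition iwahori :: "nat \<Rightarrow> 'a::field fls mat set" where
  "iwahori n = {map_mat fps_to_fls b | b :: 'a fps mat.
     b \<in> carrier (GL n) \<and> upper_triangular (map_mat (\<lambda>f. fps_nth f 0) b)}"

definition double_cosets ::
    "('g, 'x) monoid_scheme \<Rightarrow> 'g set \<Rightarrow> 'g set \<Rightarrow> 'g set set" where
  "double_cosets G H K = {H <#>\<^bsub>G\<^esub> {g} <#>\<^bsub>G\<^esub> K | g. g \<in> carrier G}"

definition monomial_mat :: "'r::zero mat \<Rightarrow> bool" where
  "monomial_mat M \<longleftrightarrow> square_mat M \<and>
     (\<forall>i < dim_row M. \<exists>!j. j < dim_col M \<and> M $$ (i, j) \<noteq> 0) \<and>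
     (\<forall>j < dim_col M. \<exists>!i. i < dim_row M \<and> M $$ (i, j) \<noteq> 0)"

definition affine_perm_mat :: "'a::field fls mat \<Rightarrow> bool" where
  "affine_perm_mat M \<longleftrightarrow> monomial_mat M \<and>
     (\<forall>i < dim_row M. \<forall>j < dim_col M.
        M $$ (i, j) \<noteq> 0 \<longrightarrow> (\<exists>a::int. M $$ (i, j) = fls_X_intpow a))"

definition SymAPM :: "nat \<Rightarrow> 'a::field fls mat set" where
  "SymAPM n = {w \<in> carrier_mat n n. affine_perm_mat w \<and> transpose_mat w = w}"

text \<open>The exponent of a non-zero entry \<open>t\<^sup>a\<close> is read off as its subdegree
  (lemma \<open>fls_subdegree_fls_X_intpow\<close>).\<close>
definition eSymAPM :: "nat \<Rightarrow> 'a::field fls mat set" where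
  "eSymAPM n = {w \<in> SymAPM n.
     even (\<Sum>(i, j) \<in> {(i, j). i < n \<and> j < n \<and> w $$ (i, j) \<noteq> 0}. fls_subdegree (w $$ (i, j)))}"

end

theory Submission
  imports Defs "Jordan_Normal_Form.Determinant"
begin

text \<open>
  The map \<open>g \<mapsto> g\<^sup>T g\<close> turns the double coset \<open>K g B\<close> into the orbit of the symmetric matrix
  \<open>X = g\<^sup>T g\<close> under the congruence action \<open>X \<mapsto> b\<^sup>T X b\<close> of the Iwahori subgroup, and two elements
  of \<open>G\<close> with the same Gram matrix differ by an orthogonal factor on the left. The theorem thus
  amounts to three facts about this action.

  Existence (\<open>iwahori_congruent_SymAPM_exists\<close>): every invertible symmetric matrix over the Laurent
  series is Iwahori-congruent to a symmetric affine permutation matrix. This is symmetric Gaussian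
  elimination. Among the entries not yet treated one takes as pivot an entry of least valuation, in
  the least possible row and then the least possible column. These tie-breaking rules are exactly
  what makes the coefficients used in the elimination integral, and divisible by \<open>t\<close> below the
  diagonal. A diagonal pivot needs the square root of a unit; for an off-diagonal pivot at \<open>(i, j)\<close>
  the plane spanned by the two basis vectors is first made hyperbolic by solving a quadratic
  equation whose discriminant is a square. Square roots of units exist in power series because the
  characteristic is not two.

  Uniqueness (\<open>iwahori_congruent_SymAPM_unique\<close>): if \<open>w' c = b\<^sup>T w\<close> with \<open>b, c\<close> in the Iwahori
  subgroup, where \<open>w\<close> and \<open>w'\<close> have the exponents \<open>a i\<close> and \<open>e i\<close> in row \<open>i\<close> and the involutions
  \<open>\<sigma>\<close> and \<open>\<tau>\<close>, comparing valuations of suitable entries gives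
  \<open>a i \<ge> e i \<ge> a (\<sigma> (\<tau> i))\<close>, the first inequality being strict if \<open>\<sigma> i < \<tau> i\<close>. Summing over \<open>i\<close>
  forces equality everywhere, so that \<open>a = e\<close> and \<open>\<tau> i \<le> \<sigma> i\<close> for all \<open>i\<close>; summing the latter
  gives \<open>\<tau> = \<sigma>\<close>.

  Parity (\<open>gram_SymAPM_imp_eSymAPM\<close> and \<open>eSymAPM_is_gram\<close>): the sum of the exponents of a symmetric
  affine permutation matrix is the valuation of its determinant, which is even for a Gram matrix.
  Conversely, if the sum is even then the number of odd exponents on the diagonal is even, so these
  can be paired up, and the matrix decomposes into blocks of size one and two, each of which is an
  explicit Gram matrix because \<open>-1\<close> is a square.
\<close>

section \<open>Valuation bounds for Laurent series\<close>

text \<open>\<open>vge m x\<close> says that \<open>x\<close> has \<open>t\<close>-adic valuation at least \<open>m\<close>. The subdegree of \<open>0\<close> is \<open>0\<close>, whereas its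
  valuation is infinite; hence the separate case.\<close>
definition vge :: "int \<Rightarrow> 'a::field fls \<Rightarrow> bool" where
  "vge m x \<longleftrightarrow> x = 0 \<or> m \<le> fls_subdegree x"

lemma vge_zero [simp]: "vge m 0"
  by (simp add: vge_def)

lemma vge_one [simp]: "vge 0 1"
  by (simp add: vge_def)

lemma vge_iff_nth: "vge m x \<longleftrightarrow> (\<forall>k<m. fls_nth x k = 0)"
proof (cases "x = 0")
  case False
  show ?thesis
  proof
    assume "\<forall>k<m. fls_nth x k = 0"
    then show "vge m x"
      using False nth_fls_subdegree_nonzero[of x] by (auto simp: vge_def not_le[symmetric])
  qed (use False in \<open>auto simp: vge_def\<close>)
qed (simp add: vge_def)

lemma vge_mono: "vge m x \<Longrightarrow> m' \<le> m \<Longrightarrow> vge m' x"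
  by (auto simp: vge_def)

lemma vge_add: "vge m x \<Longrightarrow> vge m y \<Longrightarrow> vge m (x + y)"
  by (simp add: vge_iff_nth)

lemma vge_uminus [simp]: "vge m (- x) \<longleftrightarrow> vge m x"
  by (simp add: vge_iff_nth)

lemma vge_diff: "vge m x \<Longrightarrow> vge m y \<Longrightarrow> vge m (x - y)"
  by (simp add: vge_iff_nth)

lemma vge_sum: "(\<And>k. k \<in> I \<Longrightarrow> vge m (f k)) \<Longrightarrow> vge m (sum f I)"
  by (induction I rule: infinite_finite_induct) (auto intro: vge_add)

lemma vge_mult: "vge a x \<Longrightarrow> vge b y \<Longrightarrow> m \<le> a + b \<Longrightarrow> vge m (x * y)"
  by (cases "x = 0 \<or> y = 0") (auto simp: vge_def)

lemma vge_divide: "vge a x \<Longrightarrow> q \<noteq> 0 \<Longrightarrow> m + fls_subdegree q \<le> a \<Longrightarrow> vge m (x / q)"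
  by (cases "x = 0") (auto simp: vge_def fls_divide_subdegree)

lemma vge_1_iff: "vge 0 x \<Longrightarrow> vge 1 x \<longleftrightarrow> fls_nth x 0 = 0"
proof -
  have "k < 1 \<longleftrightarrow> k < 0 \<or> k = 0" for k :: int
    by auto
  moreover assume "vge 0 x"
  ultimately show ?thesis
    by (auto simp: vge_iff_nth)
qed

lemma fls_nth_0_mult:
  assumes "vge 0 x" "vge 0 y"
  shows "fls_nth (x * y) 0 = fls_nth x 0 * fls_nth y 0"
proof -
  have x: "x = fps_to_fls (fls_regpart x)" and y: "y = fps_to_fls (fls_regpart y)"
    using assms by (auto simp: vge_def)
  have "fls_nth (fps_to_fls (fls_regpart x) * fps_to_fls (fls_regpart y)) 0
      = fps_nth (fls_regpart x * fls_regpart y) 0"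
    by (simp add: fls_times_fps_to_fls[symmetric])
  then show ?thesis
    using x y by simp
qed

lemma subdegree_eq_0_iff: "x \<noteq> 0 \<and> fls_subdegree x = 0 \<longleftrightarrow> vge 0 x \<and> fls_nth x 0 \<noteq> 0"
proof
  assume "x \<noteq> 0 \<and> fls_subdegree x = 0"
  then show "vge 0 x \<and> fls_nth x 0 \<noteq> 0"
    by (metis nth_fls_subdegree_nonzero order_refl vge_def)
next
  assume "vge 0 x \<and> fls_nth x 0 \<noteq> 0"
  then show "x \<noteq> 0 \<and> fls_subdegree x = 0"
    using fls_subdegree_leI[of x 0] by (auto simp: vge_def)
qed

lemma subdegree_add_higher:
  assumes "x \<noteq> 0" "vge (fls_subdegree x + 1) y"
  shows "x + y \<noteq> 0" "fls_subdegree (x + y) = fls_subdegree x"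
proof -
  have nz: "fls_nth (x + y) (fls_subdegree x) \<noteq> 0"
    using assms by (auto simp: vge_iff_nth)
  show "x + y \<noteq> 0"
  proof
    assume "x + y = 0"
    then show False using nz by (metis fls_zero_nth)
  qed
  have "vge (fls_subdegree x) (x + y)"
    using assms(2) by (intro vge_add) (auto simp: vge_def)
  then show "fls_subdegree (x + y) = fls_subdegree x"
    using nz \<open>x + y \<noteq> 0\<close> fls_subdegree_leI[OF nz] by (simp add: vge_def)
qed

section \<open>The Iwahori subgroup\<close>

lemma in_carrier_GL_iff:
  "b \<in> carrier (GL n) \<longleftrightarrow> b \<in> carrier_mat n n \<and> (\<exists>c \<in> carrier_mat n n. c * b = 1\<^sub>m n \<and> b * c = 1\<^sub>m n)"
  by (auto simp: GL_def units_of_def Units_def ring_mat_simps)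

lemma det_unit_imp_GL:
  fixes b :: "'r::comm_ring_1 mat"
  assumes b: "b \<in> carrier_mat n n" and d: "det b dvd 1"
  shows "b \<in> carrier (GL n)"
proof -
  obtain e where e: "1 = det b * e"
    using d by (elim dvdE)
  have adj: "adj_mat b \<in> carrier_mat n n" "b * adj_mat b = det b \<cdot>\<^sub>m 1\<^sub>m n" "adj_mat b * b = det b \<cdot>\<^sub>m 1\<^sub>m n"
    using adj_mat[OF b] by auto
  have "e \<cdot>\<^sub>m (det b \<cdot>\<^sub>m 1\<^sub>m n) = 1\<^sub>m n"
    using e by (intro eq_matI) (auto simp: mult.commute)
  then have "(e \<cdot>\<^sub>m adj_mat b) * b = 1\<^sub>m n" "b * (e \<cdot>\<^sub>m adj_mat b) = 1\<^sub>m n"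
    using adj b by (auto simp: mult_smult_assoc_mat[OF adj(1) b] mult_smult_distrib[OF b adj(1)])
  then show ?thesis
    using b adj(1) by (auto simp: in_carrier_GL_iff intro!: bexI[of _ "e \<cdot>\<^sub>m adj_mat b"])
qed

lemma GL_field_iff:
  fixes b :: "'a::field mat"
  shows "b \<in> carrier (GL n) \<longleftrightarrow> b \<in> carrier_mat n n \<and> det b \<noteq> 0"
proof
  assume "b \<in> carrier (GL n)"
  then show "b \<in> carrier_mat n n \<and> det b \<noteq> 0"
    using unit_imp_det_non_zero[of b n "()"] by (auto simp: GL_def units_of_def Units_def ring_mat_simps)
qed (auto intro!: det_unit_imp_GL simp: dvd_field_iff)

lemma comm_ring_hom_constant_term: "comm_ring_hom (\<lambda>f :: 'a::comm_ring_1 fps. fps_nth f 0)"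
  by unfold_locales auto

lemma comm_ring_hom_fps_to_fls: "comm_ring_hom (fps_to_fls :: 'a::comm_ring_1 fps \<Rightarrow> 'a fls)"
  by unfold_locales (auto simp: fls_times_fps_to_fls)

text \<open>Induction along row \<open>i\<close> from the left: once the entries of \<open>V\<close> to the left of column \<open>j\<close> are known to
  vanish, the entry \<open>(i, j)\<close> of \<open>V U\<close> is \<open>V\<^sub>i\<^sub>j U\<^sub>j\<^sub>j\<close>.\<close>
lemma upper_triangular_left_inverse:
  fixes U V :: "'a::field mat"
  assumes U: "U \<in> carrier_mat n n" and V: "V \<in> carrier_mat n n"
    and VU: "V * U = 1\<^sub>m n" and upU: "upper_triangular U" and d: "\<And>i. i < n \<Longrightarrow> U $$ (i, i) \<noteq> 0"
  shows "upper_triangular V"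
proof
  fix i j assume ij: "j < i" "i < dim_row V"
  then have i: "i < n" using V by simp
  show "V $$ (i, j) = 0"
    using ij(1)
  proof (induction j rule: less_induct)
    case (less j)
    then have j: "j < n" using i by simp
    have "0 = (V * U) $$ (i, j)"
      using VU less.prems i j by simp
    also have "\<dots> = (\<Sum>k = 0..<n. V $$ (i, k) * U $$ (k, j))"
      using U V i j by (simp add: scalar_prod_def)
    also have "\<dots> = (\<Sum>k \<in> {j}. V $$ (i, k) * U $$ (k, j))"
    proof (rule sum.mono_neutral_right)
      show "\<forall>k \<in> {0..<n} - {j}. V $$ (i, k) * U $$ (k, j) = 0"
      proof
        fix k assume k: "k \<in> {0..<n} - {j}"
        show "V $$ (i, k) * U $$ (k, j) = 0"
        proof (cases "k < j")
          case True
          then show ?thesis using less by simp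
        next
          case False
          then have "U $$ (k, j) = 0" using upU U k by auto
          then show ?thesis by simp
        qed
      qed
    qed (use j in auto)
    finally show ?case
      using d[OF j] by simp
  qed
qed

text \<open>Entrywise description of the Iwahori subgroup: the entries are power series, those below the
  diagonal are divisible by \<open>t\<close>, and the diagonal entries are units. Invertibility over the power
  series need not be required separately, since modulo \<open>t\<close> the determinant is the product of the
  diagonal entries.\<close>
lemma iwahori_iff:
  "b \<in> iwahori n \<longleftrightarrow> b \<in> carrier_mat n n
     \<and> (\<forall>i<n. \<forall>j<n. vge (if j < i then 1 else 0) (b $$ (i, j)))
     \<and> (\<forall>i<n. fls_nth (b $$ (i, i)) 0 \<noteq> 0)" (is "_ \<longleftrightarrow> ?R")
proof
  interpret c: comm_ring_hom "\<lambda>f :: 'a fps. fps_nth f 0" by (rule comm_ring_hom_constant_term)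
  assume "b \<in> iwahori n"
  then obtain p :: "'a fps mat" where p: "p \<in> carrier (GL n)" "b = map_mat fps_to_fls p"
    and up: "upper_triangular (map_mat (\<lambda>f. fps_nth f 0) p)"
    by (auto simp: iwahori_def)
  obtain q where q: "p \<in> carrier_mat n n" "q \<in> carrier_mat n n" "q * p = 1\<^sub>m n"
    using p(1) by (auto simp: in_carrier_GL_iff)
  have "det q * det p = 1"
    using det_mult[OF q(2,1)] q(3) by simp
  then have "fps_nth (det q) 0 * fps_nth (det p) 0 = 1"
    by (metis c.hom_mult c.hom_one)
  then have "det (map_mat (\<lambda>f. fps_nth f 0) p) \<noteq> 0"
    by auto
  then have "prod_list (diag_mat (map_mat (\<lambda>f. fps_nth f 0) p)) \<noteq> 0"
    using det_upper_triangular[OF up] q(1) by auto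
  then have "\<forall>i<n. fps_nth (p $$ (i, i)) 0 \<noteq> 0"
    using q(1) by (auto simp: diag_mat_def prod_list_zero_iff)
  moreover have "fps_nth (p $$ (i, j)) 0 = 0" if "i < n" "j < i" for i j
    using up q(1) that by (auto simp: upper_triangular_def)
  moreover have "vge 0 (fps_to_fls f)" for f :: "'a fps"
    by (auto simp: vge_def fls_subdegree_fls_to_fps_gt0)
  ultimately show ?R
    using q(1) p(2) by (auto simp: vge_1_iff)
next
  interpret c: comm_ring_hom "\<lambda>f :: 'a fps. fps_nth f 0" by (rule comm_ring_hom_constant_term)
  assume R: ?R
  then have b: "b \<in> carrier_mat n n" by simp
  define p where "p = map_mat fls_regpart b"
  have p: "p \<in> carrier_mat n n" using b by (simp add: p_def)
  have 0: "vge 0 (b $$ (i, j))" if "i < n" "j < n" for i j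
  proof -
    have "vge (if j < i then 1 else 0) (b $$ (i, j))"
      using R that by blast
    then show ?thesis
      by (rule vge_mono) simp
  qed
  have bp: "b = map_mat fps_to_fls p"
    using b 0 by (intro eq_matI) (force simp: p_def vge_def)+
  have up: "upper_triangular (map_mat (\<lambda>f. fps_nth f 0) p)"
    using R b by (auto simp: p_def upper_triangular_def vge_iff_nth)
  have "fps_nth (det p) 0 = det (map_mat (\<lambda>f. fps_nth f 0) p)"
    by simp
  also have "\<dots> = prod_list (diag_mat (map_mat (\<lambda>f. fps_nth f 0) p))"
    using det_upper_triangular[OF up] p by auto
  also have "\<dots> \<noteq> 0"
    using R p b by (auto simp: diag_mat_def prod_list_zero_iff p_def)
  finally have "det p dvd 1"
    by (simp add: fps_is_unit_iff)
  then show "b \<in> iwahori n"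
    using det_unit_imp_GL[OF p] bp up by (auto simp: iwahori_def)
qed

lemma iwahori_carrier: "b \<in> iwahori n \<Longrightarrow> b \<in> carrier_mat n n"
  by (simp add: iwahori_iff)

lemma iwahori_entry:
  assumes "b \<in> iwahori n" "i < n" "j < n"
  shows "vge (if j < i then 1 else 0) (b $$ (i, j))"
proof -
  have "\<forall>i<n. \<forall>j<n. vge (if j < i then 1 else 0) (b $$ (i, j))"
    using assms(1) unfolding iwahori_iff by (elim conjE)
  then show ?thesis
    using assms(2,3) by blast
qed

lemma iwahori_diag: "b \<in> iwahori n \<Longrightarrow> i < n \<Longrightarrow> fls_nth (b $$ (i, i)) 0 \<noteq> 0"
  by (simp add: iwahori_iff)

lemma iwahori_one: "1\<^sub>m n \<in> iwahori n"
  by (auto simp: iwahori_iff)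

lemma iwahori_mult:
  assumes "b \<in> iwahori n" "c \<in> iwahori n"
  shows "b * c \<in> iwahori n"
proof -
  have carr: "b \<in> carrier_mat n n" "c \<in> carrier_mat n n"
    using assms by (auto simp: iwahori_carrier)
  note b = iwahori_entry[OF assms(1)] iwahori_diag[OF assms(1)]
  note c = iwahori_entry[OF assms(2)] iwahori_diag[OF assms(2)]
  have entry: "(b * c) $$ (i, j) = (\<Sum>k = 0..<n. b $$ (i, k) * c $$ (k, j))" if "i < n" "j < n" for i j
    using carr that by (simp add: scalar_prod_def)
  have "vge (if j < i then 1 else 0) ((b * c) $$ (i, j))" if ij: "i < n" "j < n" for i j
    unfolding entry[OF ij]
  proof (rule vge_sum)
    fix k assume "k \<in> {0..<n}"
    then have k: "k < n" by simp
    show "vge (if j < i then 1 else 0) (b $$ (i, k) * c $$ (k, j))"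
      using vge_mult[OF b(1)[OF ij(1) k] c(1)[OF k ij(2)]] by (auto split: if_splits)
  qed
  moreover have "fls_nth ((b * c) $$ (i, i)) 0 \<noteq> 0" if i: "i < n" for i
  proof -
    have 0: "vge 0 (b $$ (i, k))" "vge 0 (c $$ (k, i))" if "k < n" for k
      using vge_mono[OF b(1)[OF i that], of 0] vge_mono[OF c(1)[OF that i], of 0] by auto
    have "fls_nth ((b * c) $$ (i, i)) 0 = (\<Sum>k = 0..<n. fls_nth (b $$ (i, k)) 0 * fls_nth (c $$ (k, i)) 0)"
      unfolding entry[OF i i] fls_nth_sum by (intro sum.cong) (auto simp: fls_nth_0_mult 0)
    also have "\<dots> = (\<Sum>k \<in> {i}. fls_nth (b $$ (i, k)) 0 * fls_nth (c $$ (k, i)) 0)"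
    proof (rule sum.mono_neutral_right)
      show "\<forall>k \<in> {0..<n} - {i}. fls_nth (b $$ (i, k)) 0 * fls_nth (c $$ (k, i)) 0 = 0"
      proof
        fix k assume k: "k \<in> {0..<n} - {i}"
        then show "fls_nth (b $$ (i, k)) 0 * fls_nth (c $$ (k, i)) 0 = 0"
          using b(1)[OF i, of k] c(1)[OF _ i, of k] by (cases "k < i") (auto simp: vge_iff_nth)
      qed
    qed (use i in auto)
    finally show ?thesis
      using b(2)[OF i] c(2)[OF i] by simp
  qed
  ultimately show ?thesis
    using carr unfolding iwahori_iff by (meson mult_carrier_mat)
qed

lemma iwahori_inverse:
  fixes b :: "'a::field fls mat"
  assumes "b \<in> iwahori n"
  obtains c where "c \<in> iwahori n" "c * b = 1\<^sub>m n" "b * c = 1\<^sub>m n"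
proof -
  interpret c: comm_ring_hom "\<lambda>f :: 'a fps. fps_nth f 0" by (rule comm_ring_hom_constant_term)
  interpret e: comm_ring_hom "fps_to_fls :: 'a fps \<Rightarrow> 'a fls" by (rule comm_ring_hom_fps_to_fls)
  obtain p :: "'a fps mat" where p: "p \<in> carrier (GL n)" "b = map_mat fps_to_fls p"
    and up: "upper_triangular (map_mat (\<lambda>f. fps_nth f 0) p)"
    using assms by (auto simp: iwahori_def)
  obtain q where q: "p \<in> carrier_mat n n" "q \<in> carrier_mat n n" "q * p = 1\<^sub>m n" "p * q = 1\<^sub>m n"
    using p(1) by (auto simp: in_carrier_GL_iff)
  have "upper_triangular (map_mat (\<lambda>f. fps_nth f 0) q)"
  proof (rule upper_triangular_left_inverse[OF _ _ _ up])
    show "map_mat (\<lambda>f. fps_nth f 0) q * map_mat (\<lambda>f. fps_nth f 0) p = 1\<^sub>m n"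
      using c.mat_hom_mult[OF q(2,1)] q(3) c.mat_hom_one by simp
    show "map_mat (\<lambda>f. fps_nth f 0) p $$ (i, i) \<noteq> 0" if "i < n" for i
      using assms that q(1) by (simp add: iwahori_iff p(2))
  qed (use q in auto)
  moreover have "q \<in> carrier (GL n)"
    using q by (auto simp: in_carrier_GL_iff)
  ultimately have "map_mat fps_to_fls q \<in> iwahori n"
    by (auto simp: iwahori_def)
  moreover have "map_mat fps_to_fls q * b = 1\<^sub>m n" "b * map_mat fps_to_fls q = 1\<^sub>m n"
    using e.mat_hom_mult[OF q(2,1)] e.mat_hom_mult[OF q(1,2)] q(3,4) p(2) e.mat_hom_one by auto
  ultimately show thesis
    by (rule that)
qed

section \<open>Congruence under the Iwahori subgroup\<close>

text \<open>\<open>X\<close> and \<open>Y\<close> represent the same bilinear form in bases that differ by an element of the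
  Iwahori subgroup.\<close>
definition iwahori_congruent :: "nat \<Rightarrow> 'a::field fls mat \<Rightarrow> 'a fls mat \<Rightarrow> bool" where
  "iwahori_congruent n X Y \<longleftrightarrow> X \<in> carrier_mat n n \<and> (\<exists>b \<in> iwahori n. Y = transpose_mat b * X * b)"

lemma transpose_mult3:
  fixes X :: "'a::field mat"
  assumes "b \<in> carrier_mat n n" "c \<in> carrier_mat n n" "X \<in> carrier_mat n n"
  shows "transpose_mat (b * c) * X * (b * c) = transpose_mat c * (transpose_mat b * X * b) * c"
  using assms by (simp add: transpose_mult[of _ n n _ n] assoc_mult_mat[of _ n n _ n _ n])

lemma iwahori_congruent_trans:
  assumes "iwahori_congruent n X Y" "iwahori_congruent n Y Z"
  shows "iwahori_congruent n X Z"
proof -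
  obtain b c where "b \<in> iwahori n" "Y = transpose_mat b * X * b" "c \<in> iwahori n"
      "Z = transpose_mat c * Y * c" "X \<in> carrier_mat n n"
    using assms by (auto simp: iwahori_congruent_def)
  then show ?thesis
    using transpose_mult3[of b n c X] iwahori_mult[of b n c]
    by (auto simp: iwahori_congruent_def iwahori_carrier intro!: bexI[of _ "b * c"])
qed

lemma iwahori_congruent_sym:
  assumes "iwahori_congruent n X Y"
  shows "iwahori_congruent n Y X"
proof -
  obtain b where b: "b \<in> iwahori n" "Y = transpose_mat b * X * b" "X \<in> carrier_mat n n"
    using assms by (auto simp: iwahori_congruent_def)
  obtain c where c: "c \<in> iwahori n" "b * c = 1\<^sub>m n"
    using iwahori_inverse[OF b(1)] by blast
  have "transpose_mat c * Y * c = X"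
    using transpose_mult3[of b n c X] b c by (simp add: iwahori_carrier)
  then show ?thesis
    using b c iwahori_carrier[OF b(1)] by (auto simp: iwahori_congruent_def intro!: bexI[of _ c])
qed

lemma iwahori_congruent_det:
  assumes "iwahori_congruent n X Y" "det X \<noteq> 0"
  shows "det Y \<noteq> 0"
proof -
  obtain b where b: "b \<in> iwahori n" "Y = transpose_mat b * X * b" "X \<in> carrier_mat n n"
    using assms by (auto simp: iwahori_congruent_def)
  obtain c where c: "c \<in> iwahori n" "b * c = 1\<^sub>m n"
    using iwahori_inverse[OF b(1)] by blast
  have "det b * det c = 1"
    using det_mult[of b n c] b(1) c by (simp add: iwahori_carrier)
  then have "det b \<noteq> 0"
    by auto
  then show ?thesis
    using b iwahori_carrier[OF b(1)] assms(2)
    by (simp add: det_mult[of _ n] det_transpose[of _ n])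
qed

text \<open>The congruence transform of a matrix \<open>X\<close> by the matrix \<open>1 + e\<^sub>i \<rho>\<^sup>T\<close>, which adds \<open>\<rho> k\<close>
  times the \<open>i\<close>-th basis vector to the \<open>k\<close>-th one, for all \<open>k\<close> at once. The case \<open>k = i\<close> is allowed and
  rescales the \<open>i\<close>-th basis vector by \<open>1 + \<rho> i\<close>. All the steps of the elimination have this form.\<close>
definition shear :: "nat \<Rightarrow> nat \<Rightarrow> (nat \<Rightarrow> 'a::field fls) \<Rightarrow> 'a fls mat \<Rightarrow> 'a fls mat" where
  "shear n i \<rho> X = mat n n (\<lambda>(k, l).
     X $$ (k, l) + \<rho> k * X $$ (i, l) + X $$ (k, i) * \<rho> l + \<rho> k * X $$ (i, i) * \<rho> l)"

lemma iwahori_congruent_shear: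
  assumes X: "X \<in> carrier_mat n n" and i: "i < n"
    and \<rho>: "\<And>k. k < n \<Longrightarrow> vge (if k < i then 1 else 0) (\<rho> k)"
    and u: "fls_nth (1 + \<rho> i) 0 \<noteq> 0"
  shows "iwahori_congruent n X (shear n i \<rho> X)"
proof -
  define b where "b = mat n n (\<lambda>(k, l). (if k = l then 1 else 0) + (if k = i then \<rho> l else 0))"
  have b: "b \<in> carrier_mat n n"
    by (simp add: b_def)
  have "vge (if l < k then 1 else 0) (b $$ (k, l))" if "k < n" "l < n" for k l
    using that \<rho>[of l] by (auto simp: b_def intro!: vge_add elim: vge_mono)
  then have "b \<in> iwahori n"
    using u b by (auto simp: iwahori_iff b_def)
  moreover have "shear n i \<rho> X = transpose_mat b * X * b"
  proof (rule eq_matI)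
    fix k l assume "k < dim_row (transpose_mat b * X * b)" "l < dim_col (transpose_mat b * X * b)"
    then have kl: "k < n" "l < n" using b by auto
    have 1: "(X * b) $$ (r, l) = X $$ (r, l) + X $$ (r, i) * \<rho> l" if "r < n" for r
    proof -
      have "(X * b) $$ (r, l) = (\<Sum>s = 0..<n. X $$ (r, s) * b $$ (s, l))"
        using X b that kl by (simp add: scalar_prod_def)
      also have "\<dots> = (\<Sum>s = 0..<n. (if s = l then X $$ (r, l) else 0) + (if s = i then X $$ (r, i) * \<rho> l else 0))"
        using kl by (intro sum.cong) (auto simp: b_def algebra_simps)
      finally show ?thesis
        using kl i by (simp add: sum.distrib)
    qed
    have "(transpose_mat b * X * b) $$ (k, l) = (transpose_mat b * (X * b)) $$ (k, l)"
      using b X by (simp add: assoc_mult_mat[of _ n n _ n _ n])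
    also have "\<dots> = (\<Sum>r = 0..<n. b $$ (r, k) * (X * b) $$ (r, l))"
      using X b kl by (simp add: scalar_prod_def)
    also have "\<dots> = (\<Sum>r = 0..<n. (if r = k then (X * b) $$ (k, l) else 0) + (if r = i then \<rho> k * (X * b) $$ (i, l) else 0))"
      using kl by (intro sum.cong) (auto simp: b_def algebra_simps)
    also have "\<dots> = (X * b) $$ (k, l) + \<rho> k * (X * b) $$ (i, l)"
      using kl i by (simp add: sum.distrib)
    finally show "shear n i \<rho> X $$ (k, l) = (transpose_mat b * X * b) $$ (k, l)"
      using kl i by (simp add: shear_def 1 algebra_simps)
  qed (use b in \<open>auto simp: shear_def\<close>)
  ultimately show ?thesis
    using X by (auto simp: iwahori_congruent_def)
qed

section \<open>Square roots of units\<close>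

lemma quadratically_closed_two:
  assumes "quadratically_closed TYPE('a::field)"
  shows "(2 :: 'a) \<noteq> 0"
proof
  assume "(2 :: 'a) = 0"
  then have "of_nat 2 = (0 :: 'a)" by simp
  then have "CHAR('a) dvd 2"
    by (simp only: of_nat_eq_0_iff_char_dvd)
  then have "CHAR('a) = 1 \<or> CHAR('a) = 2"
    using two_is_prime_nat prime_nat_iff by blast
  then show False
    using assms by (auto simp: quadratically_closed_def)
qed

text \<open>Coefficients of the square root, with constant term \<open>y\<close>, of the power series with coefficients \<open>f\<close>:
  comparing the coefficients of \<open>t\<^sup>n\<close> determines the \<open>n\<close>-th one, with division by \<open>2 y\<close> only. (The
  binomial series would require characteristic zero.)\<close>
fun fps_sqrt_coeff :: "'a::field \<Rightarrow> (nat \<Rightarrow> 'a) \<Rightarrow> nat \<Rightarrow> 'a" where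
  "fps_sqrt_coeff y f n = (if n = 0 then y
     else (f n - (\<Sum>k = 1..<n. fps_sqrt_coeff y f k * fps_sqrt_coeff y f (n - k))) / (2 * y))"

declare fps_sqrt_coeff.simps [simp del]

lemma fps_sqrt_exists:
  fixes f :: "'a::field fps"
  assumes "(2 :: 'a) \<noteq> 0" "y ^ 2 = fps_nth f 0" "y \<noteq> 0"
  obtains g where "g ^ 2 = f" "fps_nth g 0 = y"
proof -
  define c where "c = fps_sqrt_coeff y (fps_nth f)"
  have c0: "c 0 = y"
    by (simp add: c_def fps_sqrt_coeff.simps)
  have "fps_nth (Abs_fps c ^ 2) n = fps_nth f n" for n
  proof (cases "n = 0")
    case True
    then show ?thesis using assms c0 by (simp add: power2_eq_square)
  next
    case False
    then obtain m where m: "n = Suc m"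
      using not0_implies_Suc by blast
    have "fps_nth (Abs_fps c ^ 2) n = (\<Sum>k = 0..n. c k * c (n - k))"
      by (simp add: power2_eq_square fps_mult_nth)
    also have "{0..n} = insert 0 (insert n {1..<n})"
      using False by auto
    also have "(\<Sum>k \<in> \<dots>. c k * c (n - k)) = 2 * y * c n + (\<Sum>k = 1..<n. c k * c (n - k))"
      using False c0 by simp
    also have "c n = (fps_nth f n - (\<Sum>k = 1..<n. c k * c (n - k))) / (2 * y)"
      unfolding c_def by (subst fps_sqrt_coeff.simps) (use False in simp)
    also have "2 * y * ((fps_nth f n - (\<Sum>k = 1..<n. c k * c (n - k))) / (2 * y)) + (\<Sum>k = 1..<n. c k * c (n - k)) = fps_nth f n"
      using assms by simp
    finally show ?thesis .
  qed
  then show thesis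
    using that[of "Abs_fps c"] c0 by (auto simp: fps_eq_iff)
qed

lemma fls_sqrt_exists:
  fixes x :: "'a::field fls"
  assumes "(2 :: 'a) \<noteq> 0" "vge 0 x" "y ^ 2 = fls_nth x 0" "y \<noteq> 0"
  obtains s where "s ^ 2 = x" "vge 0 s" "fls_nth s 0 = y"
proof -
  obtain g where g: "g ^ 2 = fls_regpart x" "fps_nth g 0 = y"
    using fps_sqrt_exists[of y "fls_regpart x"] assms by auto
  have "fps_to_fls g ^ 2 = fps_to_fls (fls_regpart x)"
    using g(1) by (simp add: power2_eq_square fls_times_fps_to_fls flip: g(1))
  then have "fps_to_fls g ^ 2 = x"
    using assms(2) by (auto simp: vge_def)
  moreover have "vge 0 (fps_to_fls g)"
    by (auto simp: vge_def fls_subdegree_fls_to_fps_gt0)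
  ultimately show thesis
    using that[of "fps_to_fls g"] g(2) by simp
qed

text \<open>In a plane with Gram matrix having rows \<open>(p, q)\<close> and \<open>(q, r)\<close>, a vector \<open>c e\<^sub>1 + e\<^sub>2\<close> with integral \<open>c\<close>
  is isotropic. The valuation of \<open>p r\<close> exceeds that of \<open>q\<^sup>2\<close>, so \<open>1 - p r / q\<^sup>2\<close> has a square root \<open>s\<close>
  with constant term \<open>1\<close>.\<close>
lemma isotropic_vector_in_plane:
  fixes p q r :: "'a::field fls"
  assumes two: "(2 :: 'a) \<noteq> 0" and q: "q \<noteq> 0" "fls_subdegree q = v"
    and p: "vge (v + 1) p" and r: "vge v r"
  obtains c where "vge 0 c" "c * c * p + 2 * c * q + r = 0"
proof -
  have d: "vge 1 (p * r / q\<^sup>2)"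
    using q by (intro vge_divide[OF vge_mult[OF p r]]) (auto simp: power2_eq_square)
  have "vge 0 (1 - p * r / q\<^sup>2)"
    by (intro vge_diff vge_one vge_mono[OF d]) simp
  moreover have "fls_nth (p * r / q\<^sup>2) 0 = 0"
    using d by (simp add: vge_iff_nth)
  then have "fls_nth (1 - p * r / q\<^sup>2) 0 = 1"
    by simp
  ultimately obtain s where s: "s\<^sup>2 = 1 - p * r / q\<^sup>2" "vge 0 s" "fls_nth s 0 = 1"
    using fls_sqrt_exists[OF two, of "1 - p * r / q\<^sup>2" 1] by auto
  have "1 + s \<noteq> 0 \<and> fls_subdegree (1 + s) = 0"
    unfolding subdegree_eq_0_iff using s two by (auto intro!: vge_add)
  then have s1: "1 + s \<noteq> 0" "fls_subdegree (1 + s) = 0"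
    by auto
  \<comment> \<open>This form of the root of the quadratic polynomial stays meaningful for \<open>p = 0\<close>; its denominator has
    the valuation of \<open>q\<close> because \<open>1 + s\<close> has constant term \<open>2\<close>.\<close>
  define c where "c = - r / (q * (1 + s))"
  have "vge 0 c"
    unfolding c_def using q s1 r by (intro vge_divide[of v]) auto
  moreover have "c * c * p + 2 * c * q + r = r / (1 + s)\<^sup>2 * (p * r / q\<^sup>2 - 2 * (1 + s) + (1 + s)\<^sup>2)"
  proof -
    have "(- r / (q * d)) * (- r / (q * d)) * p + 2 * (- r / (q * d)) * q + r
        = r / d\<^sup>2 * (p * r / q\<^sup>2 - 2 * d + d\<^sup>2)" if "d \<noteq> 0" for d
      using q(1) that by (simp add: field_simps power2_eq_square)
    then show ?thesis
      using s1(1) unfolding c_def by blast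
  qed
  moreover have "p * r / q\<^sup>2 - 2 * (1 + s) + (1 + s)\<^sup>2 = 0"
    using s(1) by (simp add: power2_eq_square algebra_simps)
  ultimately show thesis
    using that[of c] by simp
qed

lemma shear_carrier [simp]: "shear n i \<rho> X \<in> carrier_mat n n"
  by (simp add: shear_def)

lemma shear_entry:
  "k < n \<Longrightarrow> l < n \<Longrightarrow> shear n i \<rho> X $$ (k, l)
     = X $$ (k, l) + \<rho> k * X $$ (i, l) + X $$ (k, i) * \<rho> l + \<rho> k * X $$ (i, i) * \<rho> l"
  by (simp add: shear_def)

lemma fls_unit_sqrt:
  fixes x :: "'a::field fls"
  assumes qc: "quadratically_closed TYPE('a)" and x: "x \<noteq> 0" "fls_subdegree x = 0"
  obtains s where "s ^ 2 = x" "vge 0 s" "fls_nth s 0 \<noteq> 0"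
proof -
  have x': "vge 0 x" "fls_nth x 0 \<noteq> 0"
    using x subdegree_eq_0_iff by blast+
  obtain y :: 'a where y: "y ^ 2 = fls_nth x 0"
    using qc unfolding quadratically_closed_def by blast
  then have "y \<noteq> 0"
    using x'(2) by auto
  then show thesis
    using fls_sqrt_exists[OF quadratically_closed_two[OF qc] x'(1) y] that by blast
qed

section \<open>Symmetric elimination\<close>

text \<open>The intermediate state of the elimination: the symmetric matrix \<open>X\<close> is already monomial, with powers
  of \<open>t\<close> as entries, in the rows (hence columns) with index in \<open>S\<close>. The unique non-zero entry of such a
  row is required to lie in a column of \<open>S\<close> as well, so that \<open>X\<close> splits into two blocks.\<close>
definition partially_monomial :: "nat \<Rightarrow> nat set \<Rightarrow> 'a::field fls mat \<Rightarrow> bool" where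
  "partially_monomial n S X \<longleftrightarrow> X \<in> carrier_mat n n \<and> transpose_mat X = X \<and> S \<subseteq> {..<n} \<and>
     (\<forall>k\<in>S. \<exists>l\<in>S. \<exists>a. X $$ (k, l) = fls_X_intpow a \<and> (\<forall>m<n. m \<noteq> l \<longrightarrow> X $$ (k, m) = 0))"

lemma symmetric_entry:
  assumes "X \<in> carrier_mat n n" "transpose_mat X = X" "k < n" "l < n"
  shows "X $$ (k, l) = X $$ (l, k)"
  using assms by (metis carrier_matD index_transpose_mat(1))

lemma partially_monomial_symmetric:
  "partially_monomial n S X \<Longrightarrow> k < n \<Longrightarrow> l < n \<Longrightarrow> X $$ (k, l) = X $$ (l, k)"
  by (auto simp: partially_monomial_def intro: symmetric_entry)

lemma partially_monomial_zero:
  assumes "partially_monomial n S X" "k \<in> S" "l < n" "l \<notin> S"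
  shows "X $$ (k, l) = 0" "X $$ (l, k) = 0"
proof -
  show 1: "X $$ (k, l) = 0"
    using assms by (fastforce simp: partially_monomial_def)
  have "k < n"
    using assms by (auto simp: partially_monomial_def)
  then show "X $$ (l, k) = 0"
    using partially_monomial_symmetric[OF assms(1) _ assms(3), of k] 1 by simp
qed

text \<open>A shear that only involves indices outside \<open>S\<close> does not affect the part already treated.\<close>
lemma partially_monomial_shear:
  assumes X: "partially_monomial n S X" and i: "i < n" "i \<notin> S"
    and \<rho>: "\<And>k. k \<in> S \<Longrightarrow> \<rho> k = 0"
  shows "partially_monomial n S (shear n i \<rho> X)"
proof -
  note sym = partially_monomial_symmetric[OF X]
  have S: "S \<subseteq> {..<n}"
    using X by (simp add: partially_monomial_def)
  have "transpose_mat (shear n i \<rho> X) = shear n i \<rho> X"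
  proof (rule eq_matI)
    fix k l assume "k < dim_row (shear n i \<rho> X)" "l < dim_col (shear n i \<rho> X)"
    then have kl: "k < n" "l < n"
      by (auto simp: shear_def)
    then show "transpose_mat (shear n i \<rho> X) $$ (k, l) = shear n i \<rho> X $$ (k, l)"
      using sym[OF kl] sym[OF kl(1) i(1)] sym[OF kl(2) i(1)]
      by (simp add: shear_def algebra_simps)
  qed (auto simp: shear_def)
  moreover have "shear n i \<rho> X $$ (k, l) = X $$ (k, l)" if "k \<in> S" "l < n" for k l
    using that S i \<rho>[of k] partially_monomial_zero(1)[OF X that(1) i]
    by (auto simp: shear_entry subset_iff)
  ultimately show ?thesis
    using X unfolding partially_monomial_def by (auto simp: subset_iff)
qed

text \<open>The entry \<open>(i, j)\<close> is a pivot: among the entries in the rows outside \<open>S\<close> it has the least valuation \<open>v\<close>,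
  no row outside \<open>S\<close> above row \<open>i\<close> contains an entry of valuation \<open>v\<close>, and neither does the part of row \<open>i\<close> to the
  left of column \<open>j\<close>. The inequality \<open>i \<le> j\<close> is a consequence of the symmetry of \<open>X\<close>.\<close>
definition pivot :: "nat \<Rightarrow> nat set \<Rightarrow> int \<Rightarrow> nat \<Rightarrow> nat \<Rightarrow> 'a::field fls mat \<Rightarrow> bool" where
  "pivot n S v i j X \<longleftrightarrow> partially_monomial n S X \<and> i < n \<and> j < n \<and> i \<notin> S \<and> j \<notin> S \<and> i \<le> j \<and>
     X $$ (i, j) \<noteq> 0 \<and> fls_subdegree (X $$ (i, j)) = v \<and>
     (\<forall>k<n. \<forall>l<n. k \<notin> S \<longrightarrow> vge (if k < i then v + 1 else v) (X $$ (k, l))) \<and>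
     (\<forall>l<j. vge (v + 1) (X $$ (i, l)))"

lemma pivot_exists:
  assumes X: "partially_monomial n S X" and k: "k < n" "k \<notin> S" and l: "l < n" and nz: "X $$ (k, l) \<noteq> 0"
  obtains v i j where "pivot n S v i j X"
proof -
  note sym = partially_monomial_symmetric[OF X]
  define E where "E = {(r, s). r < n \<and> r \<notin> S \<and> s < n \<and> X $$ (r, s) \<noteq> 0}"
  have "E \<subseteq> {..<n} \<times> {..<n}"
    by (auto simp: E_def)
  then have fin: "finite E"
    by (rule finite_subset) auto
  have ne: "(k, l) \<in> E"
    using k l nz by (simp add: E_def)
  define v where "v = Min ((\<lambda>p. fls_subdegree (X $$ p)) ` E)"
  have v_le: "v \<le> fls_subdegree (X $$ p)" if "p \<in> E" for p
    unfolding v_def using fin that by (intro Min_le) auto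
  have "v \<in> (\<lambda>p. fls_subdegree (X $$ p)) ` E"
    unfolding v_def using fin ne by (intro Min_in) auto
  then have ex: "\<exists>r s. (r, s) \<in> E \<and> fls_subdegree (X $$ (r, s)) = v"
    by auto
  define i where "i = (LEAST r. \<exists>s. (r, s) \<in> E \<and> fls_subdegree (X $$ (r, s)) = v)"
  have exi: "\<exists>s. (i, s) \<in> E \<and> fls_subdegree (X $$ (i, s)) = v"
    unfolding i_def using ex by (rule LeastI_ex)
  have i_le: "i \<le> r" if "(r, s) \<in> E" "fls_subdegree (X $$ (r, s)) = v" for r s
    unfolding i_def using that by (intro Least_le) auto
  define j where "j = (LEAST s. (i, s) \<in> E \<and> fls_subdegree (X $$ (i, s)) = v)"
  have j: "(i, j) \<in> E" "fls_subdegree (X $$ (i, j)) = v"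
    unfolding j_def using LeastI_ex[OF exi] by auto
  have j_le: "j \<le> s" if "(i, s) \<in> E" "fls_subdegree (X $$ (i, s)) = v" for s
    unfolding j_def using that by (intro Least_le) auto
  have i': "i < n" "i \<notin> S" and j': "j < n" "X $$ (i, j) \<noteq> 0"
    using j(1) by (auto simp: E_def)
  have "j \<notin> S"
    using partially_monomial_zero(2)[OF X _ i'] j'(2) by blast
  have ji: "(j, i) \<in> E"
    using \<open>j \<notin> S\<close> i' j' sym[of i j] by (simp add: E_def)
  have "i \<le> j"
    by (rule i_le[OF ji]) (use sym[OF i'(1) j'(1)] j(2) in simp)
  have "vge (if r < i then v + 1 else v) (X $$ (r, s))" if "r < n" "s < n" "r \<notin> S" for r s
  proof (cases "(r, s) \<in> E")
    case True
    then show ?thesis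
      using v_le[OF True] i_le[OF True] by (force simp: vge_def)
  qed (use that in \<open>auto simp: E_def\<close>)
  moreover have "vge (v + 1) (X $$ (i, s))" if "s < j" for s
  proof (cases "(i, s) \<in> E")
    case True
    then show ?thesis
      using v_le[OF True] j_le[OF True] that by (force simp: vge_def)
  qed (use that i' j' in \<open>auto simp: E_def\<close>)
  ultimately show thesis
    using that[of v i j] X i' j' j(2) \<open>j \<notin> S\<close> \<open>i \<le> j\<close> by (auto simp: pivot_def)
qed

lemma pivotD:
  assumes "pivot n S v i j X"
  shows "partially_monomial n S X" "i < n" "j < n" "i \<notin> S" "j \<notin> S" "i \<le> j"
    "X $$ (i, j) \<noteq> 0" "fls_subdegree (X $$ (i, j)) = v"
    "\<And>k l. k < n \<Longrightarrow> l < n \<Longrightarrow> k \<notin> S \<Longrightarrow> vge (if k < i then v + 1 else v) (X $$ (k, l))"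
    "\<And>l. l < j \<Longrightarrow> vge (v + 1) (X $$ (i, l))"
    "X \<in> carrier_mat n n"
  using assms unfolding pivot_def by (auto simp: partially_monomial_def)

lemma pivot_rescale:
  fixes X :: "'a::field fls mat"
  assumes qc: "quadratically_closed TYPE('a)" and q: "q \<noteq> (0 :: 'a fls)" "fls_subdegree q = v"
  obtains u where "u ^ 2 * q = fls_X_intpow v" "vge 0 u" "fls_nth u 0 \<noteq> 0"
proof -
  have "fls_X_intpow v / q \<noteq> 0" "fls_subdegree (fls_X_intpow v / q) = 0"
    using q by (auto simp: fls_divide_subdegree)
  then obtain u where "u ^ 2 = fls_X_intpow v / q" "vge 0 u" "fls_nth u 0 \<noteq> 0"
    using fls_unit_sqrt[OF qc] by blast
  then show thesis
    using that[of u] q(1) by simp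
qed

text \<open>A diagonal pivot: one shear clears the rest of row \<open>i\<close> and rescales the pivot to \<open>t\<^sup>v\<close>.\<close>
lemma diagonal_pivot_step:
  fixes X :: "'a::field fls mat"
  assumes qc: "quadratically_closed TYPE('a)" and piv: "pivot n S v i i X"
  obtains Y where "iwahori_congruent n X Y" "partially_monomial n (insert i S) Y"
proof -
  note P = pivotD[OF piv]
  obtain u where u: "u ^ 2 * X $$ (i, i) = fls_X_intpow v" "vge 0 u" "fls_nth u 0 \<noteq> 0"
    using pivot_rescale[OF qc P(7,8)] by blast
  define \<rho> where "\<rho> k = (if k = i then u - 1 else - X $$ (i, k) / X $$ (i, i))" for k
  define Y where "Y = shear n i \<rho> X"
  have "iwahori_congruent n X Y"
    unfolding Y_def
  proof (rule iwahori_congruent_shear[OF P(11,2)])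
    fix k assume k: "k < n"
    have "vge (if k < i then v + 1 else v) (X $$ (i, k))"
      using P(9)[OF P(2) k P(4)] P(10)[of k] by auto
    then show "vge (if k < i then 1 else 0) (\<rho> k)"
      using u P(7,8) by (auto simp: \<rho>_def intro!: vge_diff vge_divide)
  qed (use u in \<open>simp add: \<rho>_def\<close>)
  moreover have pm: "partially_monomial n S Y"
    unfolding Y_def
  proof (rule partially_monomial_shear[OF P(1,2,4)])
    fix k assume "k \<in> S"
    then show "\<rho> k = 0"
      using partially_monomial_zero(2)[OF P(1) _ P(2,4)] P(4) by (auto simp: \<rho>_def)
  qed
  have "Y $$ (i, i) = u ^ 2 * X $$ (i, i)"
    using P(2) by (simp add: Y_def shear_entry \<rho>_def power2_eq_square algebra_simps)
  then have "Y $$ (i, i) = fls_X_intpow v"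
    using u(1) by simp
  moreover have "Y $$ (i, k) = 0" if "k < n" "k \<noteq> i" for k
    using P(2,7) that by (simp add: Y_def shear_entry \<rho>_def field_simps)
  ultimately show thesis
    using that[of Y] pm P(2) unfolding partially_monomial_def by (metis insert_iff insert_subset lessThan_iff)
qed

text \<open>An off-diagonal pivot at \<open>(i, j)\<close> is treated in four shears. The first one replaces the \<open>j\<close>-th basis
  vector by an isotropic one; since \<open>i < j\<close>, integral multiples of the \<open>i\<close>-th one may be added.\<close>
lemma off_diagonal_pivot_clear_second:
  fixes X :: "'a::field fls mat"
  assumes two: "(2 :: 'a) \<noteq> 0" and piv: "pivot n S v i j X" and ij: "i < j"
  obtains Y where "iwahori_congruent n X Y" "pivot n S v i j Y" "Y $$ (j, j) = 0"
proof -
  note P = pivotD[OF piv]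
  note sym = partially_monomial_symmetric[OF P(1)]
  obtain c where c: "vge 0 c" "c * c * X $$ (i, i) + 2 * c * X $$ (i, j) + X $$ (j, j) = 0"
    using isotropic_vector_in_plane[OF two P(7,8) P(10)[OF ij], of "X $$ (j, j)"] P(9)[OF P(3,3,5)] ij
    by auto
  define \<rho> where "\<rho> k = (if k = j then c else 0)" for k
  define Y where "Y = shear n i \<rho> X"
  have "iwahori_congruent n X Y"
    unfolding Y_def
    by (rule iwahori_congruent_shear[OF P(11,2)]) (use c ij in \<open>auto simp: \<rho>_def\<close>)
  moreover have "pivot n S v i j Y"
    unfolding pivot_def
  proof (intro conjI allI impI)
    show "partially_monomial n S Y"
      unfolding Y_def by (rule partially_monomial_shear[OF P(1,2,4)]) (use P(5) in \<open>auto simp: \<rho>_def\<close>)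
    have Yij: "Y $$ (i, j) = X $$ (i, j) + c * X $$ (i, i)"
      using P(2,3) ij by (simp add: Y_def shear_entry \<rho>_def algebra_simps)
    have "vge (fls_subdegree (X $$ (i, j)) + 1) (c * X $$ (i, i))"
      using vge_mult[OF c(1) P(10)[OF ij]] P(8) by simp
    then show "Y $$ (i, j) \<noteq> 0" "fls_subdegree (Y $$ (i, j)) = v"
      unfolding Yij using subdegree_add_higher[OF P(7)] P(8) by auto
    show "vge (v + 1) (Y $$ (i, l))" if "l < j" for l
      using that P(2,3) ij P(10)[OF that] by (simp add: Y_def shear_entry \<rho>_def)
    show "vge (if k < i then v + 1 else v) (Y $$ (k, l))" if kl: "k < n" "l < n" and k: "k \<notin> S" for k l
    proof -
      have 1: "vge (if k < i then v + 1 else v) (\<rho> k * y)" if "vge v y" for y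
        using ij vge_mult[OF c(1) that, of v] by (auto simp: \<rho>_def)
      have 2: "vge v (X $$ (i, r))" if "r < n" for r
        using P(9)[OF P(2) that P(4)] by simp
      have 3: "vge 0 (\<rho> l)"
        using c(1) by (simp add: \<rho>_def)
      show ?thesis
        unfolding Y_def shear_entry[OF kl] mult.assoc
        by (intro vge_add 1 2 P(9)[OF kl k] vge_mult[OF P(9)[OF kl(1) P(2) k] 3]
            vge_mult[OF 2[OF P(2)] 3]) (use kl in auto)
    qed
  qed (use P ij in auto)
  moreover have "Y $$ (j, j) = c * c * X $$ (i, i) + 2 * c * X $$ (i, j) + X $$ (j, j)"
    using P(2,3) sym[OF P(3,2)] by (simp add: Y_def shear_entry \<rho>_def algebra_simps)
  ultimately show thesis
    using that c(2) by metis
qed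

text \<open>Once the \<open>j\<close>-th basis vector is isotropic, the condition that the \<open>i\<close>-th one becomes isotropic is linear.
  Its solution is divisible by \<open>t\<close>, as required because \<open>i < j\<close>: the entry \<open>(i, i)\<close> lies to the left of
  the pivot and thus has a larger valuation.\<close>
lemma off_diagonal_pivot_clear_first:
  fixes X :: "'a::field fls mat"
  assumes two: "(2 :: 'a) \<noteq> 0" and piv: "pivot n S v i j X" and ij: "i < j" and jj: "X $$ (j, j) = 0"
  obtains Y where "iwahori_congruent n X Y" "pivot n S v i j Y" "Y $$ (j, j) = 0" "Y $$ (i, i) = 0"
proof -
  note P = pivotD[OF piv]
  note sym = partially_monomial_symmetric[OF P(1)]
  have "(2 :: 'a fls) = 1 + 1"
    by simp
  then have "vge 0 (2 :: 'a fls) \<and> fls_nth (2 :: 'a fls) 0 \<noteq> 0"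
    using two vge_add[OF vge_one vge_one] by (metis fls_plus_nth fls_one_nth one_add_one)
  then have two': "(2 :: 'a fls) \<noteq> 0" "fls_subdegree (2 :: 'a fls) = 0"
    using subdegree_eq_0_iff by blast+
  define d where "d = - X $$ (i, i) / (2 * X $$ (i, j))"
  have d: "vge 1 d"
    unfolding d_def using P(7,8) P(10)[OF ij] two' by (intro vge_divide[of "v + 1"]) auto
  define \<rho> where "\<rho> k = (if k = i then d else 0)" for k
  define Y where "Y = shear n j \<rho> X"
  have entry: "Y $$ (k, l) = X $$ (k, l) + \<rho> k * X $$ (j, l) + X $$ (k, j) * \<rho> l" if "k < n" "l < n" for k l
    using that jj by (simp add: Y_def shear_entry)
  have "iwahori_congruent n X Y"
    unfolding Y_def
    by (rule iwahori_congruent_shear[OF P(11,3)]) (use d ij in \<open>auto simp: \<rho>_def\<close>)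
  moreover have Yij: "Y $$ (i, j) = X $$ (i, j)" "Y $$ (j, j) = 0"
    using P(2,3) ij jj by (auto simp: entry \<rho>_def)
  have Yii: "Y $$ (i, i) = 0"
    using P(2,3,7) two' sym[OF P(3,2)] by (simp add: entry \<rho>_def d_def field_simps)
  have "pivot n S v i j Y"
    unfolding pivot_def
  proof (intro conjI allI impI)
    show "partially_monomial n S Y"
      unfolding Y_def by (rule partially_monomial_shear[OF P(1,3,5)]) (use P(4) in \<open>auto simp: \<rho>_def\<close>)
    have 2: "vge v (X $$ (j, l))" if "l < n" for l
      using P(9)[OF P(3) that P(5)] ij by simp
    show "vge (v + 1) (Y $$ (i, l))" if l: "l < j" for l
    proof (cases "l = i")
      case False
      then show ?thesis
        using l P(2,3) P(10)[OF l] vge_mult[OF d 2, of l "v + 1"]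
        by (auto simp: entry \<rho>_def intro!: vge_add)
    qed (simp add: Yii)
    show "vge (if k < i then v + 1 else v) (Y $$ (k, l))" if kl: "k < n" "l < n" and k: "k \<notin> S" for k l
    proof -
      have 1: "vge (if k < i then v + 1 else v) (\<rho> k * X $$ (j, l))"
        using vge_mult[OF d 2[OF kl(2)], of v] by (auto simp: \<rho>_def)
      have 3: "vge 0 (\<rho> l)"
        using vge_mono[OF d, of 0] by (simp add: \<rho>_def)
      show ?thesis
        unfolding entry[OF kl]
        by (intro vge_add 1 vge_mult[OF P(9)[OF kl(1) P(3) k] 3] P(9)[OF kl k]) auto
    qed
  qed (use P ij Yij in auto)
  ultimately show thesis
    using that Yij Yii by metis
qed

text \<open>Multiples of the \<open>i\<close>-th basis vector clear row \<open>j\<close> outside the hyperbolic plane; at the same time that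
  vector is rescaled such that the pivot becomes \<open>t\<^sup>v\<close>. The valuation bounds on row \<open>i\<close> are kept for the
  final shear.\<close>
lemma off_diagonal_pivot_clear_second_row:
  fixes X :: "'a::field fls mat"
  assumes qc: "quadratically_closed TYPE('a)" and piv: "pivot n S v i j X" and ij: "i < j"
    and jj: "X $$ (j, j) = 0" and ii: "X $$ (i, i) = 0"
  obtains Y where "iwahori_congruent n X Y" "partially_monomial n S Y" "Y $$ (i, j) = fls_X_intpow v"
    "Y $$ (i, i) = 0" "\<And>k. k < n \<Longrightarrow> k \<noteq> i \<Longrightarrow> Y $$ (j, k) = 0"
    "\<And>k. k < n \<Longrightarrow> vge (if k < j then v + 1 else v) (Y $$ (i, k))"
proof -
  note P = pivotD[OF piv]
  note sym = partially_monomial_symmetric[OF P(1)]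
  define q where "q = X $$ (i, j)"
  have q: "q \<noteq> 0" "fls_subdegree q = v" "X $$ (i, j) = q" "X $$ (j, i) = q"
    using P(2,3,7,8) sym[of i j] by (auto simp: q_def)
  define u where "u = fls_X_intpow v / q"
  have u: "vge 0 u" "fls_nth u 0 \<noteq> 0" "u * q = fls_X_intpow v"
    using q subdegree_eq_0_iff[of u] by (auto simp: u_def fls_divide_subdegree)
  define \<rho> where "\<rho> k = (if k = i then u - 1 else if k = j then 0 else - X $$ (j, k) / q)" for k
  define Y where "Y = shear n i \<rho> X"
  have entry: "Y $$ (k, l) = X $$ (k, l) + \<rho> k * X $$ (i, l) + X $$ (k, i) * \<rho> l" if "k < n" "l < n" for k l
    using that ii by (simp add: Y_def shear_entry)
  have "iwahori_congruent n X Y"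
    unfolding Y_def
  proof (rule iwahori_congruent_shear[OF P(11,2)])
    fix k assume k: "k < n"
    have "vge (if k < i then v + 1 else v) (X $$ (j, k))"
    proof (cases "k \<in> S")
      case True
      then show ?thesis
        using partially_monomial_zero(2)[OF P(1) _ P(3,5)] by simp
    next
      case False
      then show ?thesis
        using P(9)[OF k P(3)] sym[OF P(3) k] by simp
    qed
    then show "vge (if k < i then 1 else 0) (\<rho> k)"
      using u q by (auto simp: \<rho>_def intro!: vge_diff vge_divide)
  qed (use u in \<open>simp add: \<rho>_def\<close>)
  moreover have "partially_monomial n S Y"
    unfolding Y_def
  proof (rule partially_monomial_shear[OF P(1,2,4)])
    fix k assume "k \<in> S"
    then show "\<rho> k = 0"
      using partially_monomial_zero(2)[OF P(1) _ P(3,5)] P(4,5) by (auto simp: \<rho>_def)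
  qed
  moreover have Yi: "Y $$ (i, k) = u * X $$ (i, k)" if "k < n" for k
    using that P(2) ii by (simp add: entry \<rho>_def algebra_simps)
  have "Y $$ (i, j) = fls_X_intpow v" "Y $$ (i, i) = 0"
    using P(2,3) u q ii by (auto simp: Yi)
  moreover have "Y $$ (j, k) = 0" if "k < n" "k \<noteq> i" for k
    using that P(3) ij q jj by (auto simp: entry \<rho>_def)
  moreover have "vge (if k < j then v + 1 else v) (Y $$ (i, k))" if k: "k < n" for k
  proof -
    have "vge (if k < j then v + 1 else v) (X $$ (i, k))"
      using P(9)[OF P(2) k P(4)] P(10)[of k] by auto
    then show ?thesis
      unfolding Yi[OF k] by (rule vge_mult[OF u(1)]) simp
  qed
  ultimately show thesis
    using that by metis
qed

text \<open>The fourth shear clears row \<open>i\<close> by multiples of the \<open>j\<close>-th basis vector. The bounds on row \<open>i\<close> make the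
  coefficients for \<open>k < j\<close> divisible by \<open>t\<close>.\<close>
lemma off_diagonal_pivot_step:
  fixes X :: "'a::field fls mat"
  assumes qc: "quadratically_closed TYPE('a)" and piv: "pivot n S v i j X" and ij: "i < j"
  obtains Y where "iwahori_congruent n X Y" "partially_monomial n (insert i (insert j S)) Y"
proof -
  note P = pivotD[OF piv]
  note two = quadratically_closed_two[OF qc]
  obtain X1 where X1: "iwahori_congruent n X X1" "pivot n S v i j X1" "X1 $$ (j, j) = 0"
    using off_diagonal_pivot_clear_second[OF two piv ij] by blast
  obtain X2 where X2: "iwahori_congruent n X1 X2" "pivot n S v i j X2" "X2 $$ (j, j) = 0" "X2 $$ (i, i) = 0"
    using off_diagonal_pivot_clear_first[OF two X1(2) ij X1(3)] by blast
  obtain Z where Z: "iwahori_congruent n X2 Z" "partially_monomial n S Z" "Z $$ (i, j) = fls_X_intpow v"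
    "Z $$ (i, i) = 0" "\<And>k. k < n \<Longrightarrow> k \<noteq> i \<Longrightarrow> Z $$ (j, k) = 0"
    "\<And>k. k < n \<Longrightarrow> vge (if k < j then v + 1 else v) (Z $$ (i, k))"
    using off_diagonal_pivot_clear_second_row[OF qc X2(2) ij X2(3,4)] by blast
  note sym = partially_monomial_symmetric[OF Z(2)]
  define \<rho> where "\<rho> k = (if k = i \<or> k = j then 0 else - Z $$ (i, k) / fls_X_intpow v)" for k
  define Y where "Y = shear n j \<rho> Z"
  have Zji: "Z $$ (j, i) = fls_X_intpow v"
    using sym[OF P(2,3)] Z(3) by simp
  have Zjj: "Z $$ (j, j) = 0"
    using Z(5) P(3) ij by simp
  have entry: "Y $$ (k, l) = Z $$ (k, l) + \<rho> k * Z $$ (j, l) + Z $$ (k, j) * \<rho> l" if "k < n" "l < n" for k l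
    using that Zjj by (simp add: Y_def shear_entry)
  have "iwahori_congruent n Z Y"
    unfolding Y_def
  proof (rule iwahori_congruent_shear[OF _ P(3)])
    show "Z \<in> carrier_mat n n"
      using Z(2) by (simp add: partially_monomial_def)
    fix k assume k: "k < n"
    show "vge (if k < j then 1 else 0) (\<rho> k)"
      using Z(6)[OF k] by (auto simp: \<rho>_def intro!: vge_divide)
  qed (simp add: \<rho>_def)
  then have "iwahori_congruent n X Y"
    using X1(1) X2(1) Z(1) iwahori_congruent_trans by blast
  moreover have pm: "partially_monomial n S Y"
    unfolding Y_def
  proof (rule partially_monomial_shear[OF Z(2) P(3,5)])
    fix k assume "k \<in> S"
    then show "\<rho> k = 0"
      using partially_monomial_zero(2)[OF Z(2) _ P(2,4)] by (auto simp: \<rho>_def)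
  qed
  moreover have "Y $$ (i, j) = fls_X_intpow v" "Y $$ (j, i) = fls_X_intpow v"
    using P(2,3) Z(3) Zji Zjj by (auto simp: entry \<rho>_def)
  moreover have "Y $$ (i, k) = 0" if "k < n" "k \<noteq> j" for k
    using that P(2) Z(3,4) by (auto simp: entry \<rho>_def)
  moreover have "Y $$ (j, k) = 0" if "k < n" "k \<noteq> i" for k
    using that P(3) Z(5) Zjj by (auto simp: entry \<rho>_def)
  ultimately show thesis
    using that[of Y] P(2,3) unfolding partially_monomial_def
    by (metis insert_iff insert_subset lessThan_iff)
qed

section \<open>Symmetric affine permutation matrices\<close>

text \<open>The matrix whose entry at \<open>(i, \<sigma> i)\<close> is \<open>t\<close> to the power \<open>a i\<close>, for all \<open>i < n\<close>, with zeros
  elsewhere.\<close>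
definition apm :: "nat \<Rightarrow> (nat \<Rightarrow> nat) \<Rightarrow> (nat \<Rightarrow> int) \<Rightarrow> 'a::field fls mat" where
  "apm n \<sigma> a = mat n n (\<lambda>(i, j). if j = \<sigma> i then fls_X_intpow (a i) else 0)"

lemma apm_carrier [simp]: "apm n \<sigma> a \<in> carrier_mat n n"
  by (simp add: apm_def)

lemma apm_entry:
  "i < n \<Longrightarrow> j < n \<Longrightarrow> apm n \<sigma> a $$ (i, j) = (if j = \<sigma> i then fls_X_intpow (a i) else 0)"
  by (simp add: apm_def)

text \<open>The data describing a symmetric affine permutation matrix: an involution \<open>\<sigma>\<close> of \<open>{..<n}\<close> and an
  exponent function that is invariant under it. No condition is imposed outside \<open>{..<n}\<close>.\<close>
definition weighted_involution :: "nat \<Rightarrow> (nat \<Rightarrow> nat) \<Rightarrow> (nat \<Rightarrow> int) \<Rightarrow> bool" where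
  "weighted_involution n \<sigma> a \<longleftrightarrow> (\<forall>i<n. \<sigma> i < n \<and> \<sigma> (\<sigma> i) = i \<and> a (\<sigma> i) = a i)"

lemma symmetric_row_monomial_in_SymAPM:
  assumes X: "X \<in> carrier_mat n n" "transpose_mat X = X"
    and row: "\<And>k. k < n \<Longrightarrow> \<exists>l<n. \<exists>a. X $$ (k, l) = fls_X_intpow a \<and> (\<forall>m<n. m \<noteq> l \<longrightarrow> X $$ (k, m) = 0)"
  shows "X \<in> SymAPM n"
proof -
  note sym = symmetric_entry[OF X]
  have ex1: "\<exists>!j. j < n \<and> X $$ (i, j) \<noteq> 0" if "i < n" for i
    using row[OF that] by (metis fls_X_intpow_nonzero)
  moreover have "\<exists>!i. i < n \<and> X $$ (i, j) \<noteq> 0" if "j < n" for j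
    using ex1[OF that] sym that by metis
  moreover have "\<exists>a. X $$ (i, j) = fls_X_intpow a" if "i < n" "j < n" "X $$ (i, j) \<noteq> 0" for i j
    using row[of i] that by metis
  ultimately show ?thesis
    using X by (auto simp: SymAPM_def affine_perm_mat_def monomial_mat_def square_mat.simps)
qed

lemma SymAPM_iff:
  "w \<in> SymAPM n \<longleftrightarrow> (\<exists>\<sigma> a. weighted_involution n \<sigma> a \<and> w = apm n \<sigma> a)"
proof
  assume "w \<in> SymAPM n"
  then have w: "w \<in> carrier_mat n n" "transpose_mat w = w" and mono: "monomial_mat w"
    and pow: "\<And>i j. i < n \<Longrightarrow> j < n \<Longrightarrow> w $$ (i, j) \<noteq> 0 \<Longrightarrow> \<exists>a. w $$ (i, j) = fls_X_intpow a"
    by (auto simp: SymAPM_def affine_perm_mat_def)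
  have row: "\<exists>!j. j < n \<and> w $$ (i, j) \<noteq> 0" if "i < n" for i
  proof -
    have "\<forall>i < dim_row w. \<exists>!j. j < dim_col w \<and> w $$ (i, j) \<noteq> 0"
      using mono unfolding monomial_mat_def by (elim conjE)
    then show ?thesis
      using that unfolding carrier_matD[OF w(1)] by (elim allE impE)
  qed
  note sym = symmetric_entry[OF w]
  define \<sigma> where "\<sigma> i = (THE j. j < n \<and> w $$ (i, j) \<noteq> 0)" for i
  have \<sigma>: "\<sigma> i < n" "w $$ (i, \<sigma> i) \<noteq> 0" if "i < n" for i
    using theI'[OF row[OF that]] by (auto simp: \<sigma>_def)
  have \<sigma>_eq: "\<sigma> i = j" if "i < n" "j < n" "w $$ (i, j) \<noteq> 0" for i j
    using row[OF that(1)] \<sigma>[OF that(1)] that by blast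
  define a where "a i = fls_subdegree (w $$ (i, \<sigma> i))" for i
  have a: "w $$ (i, \<sigma> i) = fls_X_intpow (a i)" if "i < n" for i
    using pow[OF that \<sigma>[OF that]] by (auto simp: a_def)
  have "\<sigma> (\<sigma> i) = i" if "i < n" for i
    using \<sigma>_eq[of "\<sigma> i" i] \<sigma>[OF that] sym[of i "\<sigma> i"] that by simp
  moreover have "a (\<sigma> i) = a i" if "i < n" for i
    using calculation[OF that] \<sigma>[OF that] sym[of i "\<sigma> i"] that by (simp add: a_def)
  ultimately have "weighted_involution n \<sigma> a"
    using \<sigma> by (simp add: weighted_involution_def)
  moreover have "w = apm n \<sigma> a"
  proof (rule eq_matI)
    fix i j assume "i < dim_row (apm n \<sigma> a)" "j < dim_col (apm n \<sigma> a)"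
    then have ij: "i < n" "j < n"
      by (auto simp: apm_def)
    show "w $$ (i, j) = apm n \<sigma> a $$ (i, j)"
    proof (cases "j = \<sigma> i")
      case True
      then show ?thesis
        using a[OF ij(1)] ij by (simp add: apm_entry)
    next
      case False
      then have "w $$ (i, j) = 0"
        using \<sigma>_eq[OF ij] by blast
      then show ?thesis
        using False ij by (simp add: apm_entry)
    qed
  qed (use w(1) in \<open>auto simp: apm_def\<close>)
  ultimately show "\<exists>\<sigma> a. weighted_involution n \<sigma> a \<and> w = apm n \<sigma> a"
    by blast
next
  assume "\<exists>\<sigma> a. weighted_involution n \<sigma> a \<and> w = apm n \<sigma> a"
  then obtain \<sigma> a where w: "weighted_involution n \<sigma> a" "w = apm n \<sigma> a"
    by blast
  show "w \<in> SymAPM n"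
  proof (rule symmetric_row_monomial_in_SymAPM)
    show "w \<in> carrier_mat n n"
      using w by simp
    show "transpose_mat w = w"
      using w by (intro eq_matI) (auto simp: apm_def weighted_involution_def)
    fix k assume k: "k < n"
    then show "\<exists>l<n. \<exists>a. w $$ (k, l) = fls_X_intpow a \<and> (\<forall>m<n. m \<noteq> l \<longrightarrow> w $$ (k, m) = 0)"
      using w by (intro exI[of _ "\<sigma> k"]) (auto simp: apm_entry weighted_involution_def)
  qed
qed

lemma apm_in_eSymAPM_iff:
  assumes "weighted_involution n \<sigma> a"
  shows "(apm n \<sigma> a :: 'a::field fls mat) \<in> eSymAPM n \<longleftrightarrow> even (\<Sum>i<n. a i)"
proof -
  let ?w = "apm n \<sigma> a :: 'a fls mat"
  have \<sigma>: "\<sigma> i < n" if "i < n" for i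
    using assms that by (simp add: weighted_involution_def)
  have "i < n \<and> j < n \<and> ?w $$ (i, j) \<noteq> 0 \<longleftrightarrow> i < n \<and> j = \<sigma> i" for i j
  proof -
    have "?w $$ (i, j) \<noteq> 0 \<longleftrightarrow> j = \<sigma> i" if "i < n" "j < n"
      using that by (simp add: apm_entry)
    then show ?thesis
      using \<sigma> by blast
  qed
  then have "{(i, j). i < n \<and> j < n \<and> ?w $$ (i, j) \<noteq> 0} = (\<lambda>i. (i, \<sigma> i)) ` {..<n}"
    by blast
  moreover have "inj_on (\<lambda>i. (i, \<sigma> i)) {..<n}"
    by (auto simp: inj_on_def)
  ultimately have "(\<Sum>(i, j) \<in> {(i, j). i < n \<and> j < n \<and> ?w $$ (i, j) \<noteq> 0}. fls_subdegree (?w $$ (i, j)))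
      = (\<Sum>i<n. fls_subdegree (?w $$ (i, \<sigma> i)))"
    by (simp add: sum.reindex)
  also have "\<dots> = (\<Sum>i<n. a i)"
    by (intro sum.cong) (simp_all add: apm_entry \<sigma>)
  finally show ?thesis
    using assms SymAPM_iff[of ?w n] by (auto simp: eSymAPM_def)
qed

section \<open>Representatives of the congruence classes\<close>

theorem iwahori_congruent_SymAPM_exists:
  fixes X :: "'a::field fls mat"
  assumes qc: "quadratically_closed TYPE('a)" and X: "X \<in> carrier_mat n n" "transpose_mat X = X"
    and nz: "det X \<noteq> 0"
  obtains w where "w \<in> SymAPM n" "iwahori_congruent n X w"
proof -
  \<comment> \<open>Induction on the number of indices outside \<open>S\<close>.\<close>
  have "partially_monomial n S X \<Longrightarrow> det X \<noteq> 0 \<Longrightarrow> \<exists>w \<in> SymAPM n. iwahori_congruent n X w" for S and X :: "'a fls mat"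
  proof (induction "card ({..<n} - S)" arbitrary: S X rule: less_induct)
    case less
    note pm = less.prems(1)
    have S: "S \<subseteq> {..<n}" and X: "X \<in> carrier_mat n n"
      using pm by (auto simp: partially_monomial_def)
    have IH: "\<exists>w \<in> SymAPM n. iwahori_congruent n X w"
      if Y: "iwahori_congruent n X Y" "partially_monomial n S' Y" and S': "S \<subset> S'" for Y S'
    proof -
      have "S' \<subseteq> {..<n}"
        using Y(2) by (simp add: partially_monomial_def)
      then have "{..<n} - S' \<subset> {..<n} - S"
        using S' by blast
      then have "card ({..<n} - S') < card ({..<n} - S)"
        by (intro psubset_card_mono) auto
      from less.hyps[OF this Y(2) iwahori_congruent_det[OF Y(1) less.prems(2)]]
      show ?thesis
        using iwahori_congruent_trans[OF Y(1)] by blast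
    qed
    show ?case
    proof (cases "S = {..<n}")
      case True
      have "X \<in> SymAPM n"
      proof (rule symmetric_row_monomial_in_SymAPM[OF X])
        show "transpose_mat X = X"
          using pm by (simp add: partially_monomial_def)
        fix k assume "k < n"
        then have "\<exists>l\<in>S. \<exists>a. X $$ (k, l) = fls_X_intpow a \<and> (\<forall>m<n. m \<noteq> l \<longrightarrow> X $$ (k, m) = 0)"
          using pm True unfolding partially_monomial_def by blast
        then show "\<exists>l<n. \<exists>a. X $$ (k, l) = fls_X_intpow a \<and> (\<forall>m<n. m \<noteq> l \<longrightarrow> X $$ (k, m) = 0)"
          unfolding True by blast
      qed
      moreover have "iwahori_congruent n X X"
        using X by (auto simp: iwahori_congruent_def intro!: bexI[of _ "1\<^sub>m n"] iwahori_one)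
      ultimately show ?thesis
        by blast
    next
      case False
      then obtain k where k: "k < n" "k \<notin> S"
        using S by auto
      \<comment> \<open>By invertibility a row outside \<open>S\<close> is non-zero, so there is a pivot.\<close>
      have "\<exists>l<n. X $$ (k, l) \<noteq> 0"
      proof (rule ccontr)
        assume "\<not> ?thesis"
        then have "(\<Prod>i = 0..<n. X $$ (i, p i)) = 0" if "p permutes {0..<n}" for p
          using permutes_in_image[OF that, of k] k by (intro prod_zero) auto
        then have "det X = 0"
          unfolding det_def'[OF X] by (intro sum.neutral) simp
        then show False
          using less.prems(2) by simp
      qed
      then obtain l where "l < n" "X $$ (k, l) \<noteq> 0"
        by blast
      then obtain v i j where piv: "pivot n S v i j X"
        using pivot_exists[OF pm k] by blast
      show ?thesis
      proof (cases "i = j")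
        case True
        obtain Y where "iwahori_congruent n X Y" "partially_monomial n (insert i S) Y"
          using diagonal_pivot_step[OF qc] piv True by blast
        then show ?thesis
          by (rule IH) (use pivotD(4)[OF piv] in blast)
      next
        case False
        then have "i < j"
          using pivotD(6)[OF piv] by simp
        then obtain Y where "iwahori_congruent n X Y" "partially_monomial n (insert i (insert j S)) Y"
          using off_diagonal_pivot_step[OF qc piv] by blast
        then show ?thesis
          by (rule IH) (use pivotD(4)[OF piv] in blast)
      qed
    qed
  qed
  from this[of "{}" X] show thesis
    using that X nz by (auto simp: partially_monomial_def)
qed

lemma weighted_involution_permutes:
  assumes "weighted_involution n \<sigma> a"
  shows "bij_betw \<sigma> {..<n} {..<n}"
  by (rule bij_betw_byWitness[of _ \<sigma>]) (use assms in \<open>auto simp: weighted_involution_def\<close>)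

theorem iwahori_congruent_SymAPM_unique:
  assumes w: "w \<in> SymAPM n" and w': "w' \<in> SymAPM n" and con: "iwahori_congruent n w w'"
  shows "w = w'"
proof -
  obtain \<sigma> a where s: "weighted_involution n \<sigma> a" "w = apm n \<sigma> a"
    using w by (auto simp: SymAPM_iff)
  obtain \<tau> e where t: "weighted_involution n \<tau> e" "w' = apm n \<tau> e"
    using w' by (auto simp: SymAPM_iff)
  have \<sigma>: "\<sigma> i < n" "\<sigma> (\<sigma> i) = i" "a (\<sigma> i) = a i" if "i < n" for i
    using s that by (auto simp: weighted_involution_def)
  have \<tau>: "\<tau> i < n" "\<tau> (\<tau> i) = i" "e (\<tau> i) = e i" if "i < n" for i
    using t that by (auto simp: weighted_involution_def)
  obtain b where b: "b \<in> iwahori n" "w' = transpose_mat b * w * b"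
    using con by (auto simp: iwahori_congruent_def)
  obtain c where c: "c \<in> iwahori n" "b * c = 1\<^sub>m n"
    using iwahori_inverse[OF b(1)] by blast
  have carr: "b \<in> carrier_mat n n" "c \<in> carrier_mat n n" "w \<in> carrier_mat n n" "w' \<in> carrier_mat n n"
    using b(1) c(1) by (auto simp: iwahori_carrier s(2) t(2))
  have "w' * c = transpose_mat b * w * (b * c)"
    unfolding b(2) using carr by (simp add: assoc_mult_mat[of _ n n _ n _ n])
  then have eq: "w' * c = transpose_mat b * w"
    using carr c(2) by simp
  have entry: "fls_X_intpow (e i) * c $$ (\<tau> i, l) = b $$ (\<sigma> l, i) * fls_X_intpow (a l)"
    if i: "i < n" and l: "l < n" for i l
  proof -
    have "(w' * c) $$ (i, l) = (\<Sum>k = 0..<n. w' $$ (i, k) * c $$ (k, l))"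
      using carr i l by (simp add: scalar_prod_def)
    also have "\<dots> = (\<Sum>k = 0..<n. if k = \<tau> i then fls_X_intpow (e i) * c $$ (\<tau> i, l) else 0)"
      using i l by (intro sum.cong) (auto simp: t(2) apm_entry)
    also have "\<dots> = fls_X_intpow (e i) * c $$ (\<tau> i, l)"
      using \<tau>(1)[OF i] by simp
    finally have 1: "(w' * c) $$ (i, l) = fls_X_intpow (e i) * c $$ (\<tau> i, l)" .
    have "(transpose_mat b * w) $$ (i, l) = (\<Sum>k = 0..<n. b $$ (k, i) * w $$ (k, l))"
      using carr i l by (simp add: scalar_prod_def)
    also have "\<dots> = (\<Sum>k = 0..<n. if k = \<sigma> l then b $$ (\<sigma> l, i) * fls_X_intpow (a l) else 0)"
      using i l \<sigma> by (intro sum.cong) (auto simp: s(2) apm_entry)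
    also have "\<dots> = b $$ (\<sigma> l, i) * fls_X_intpow (a l)"
      using \<sigma>(1)[OF l] by simp
    finally show ?thesis
      using 1 eq by simp
  qed
  have diag: "b $$ (i, i) \<noteq> 0 \<and> fls_subdegree (b $$ (i, i)) = 0"
    "c $$ (i, i) \<noteq> 0 \<and> fls_subdegree (c $$ (i, i)) = 0" if "i < n" for i
    using iwahori_entry[OF b(1) that that] iwahori_diag[OF b(1) that]
      iwahori_entry[OF c(1) that that] iwahori_diag[OF c(1) that] by (auto simp: subdegree_eq_0_iff)
  have le1: "e i + (if \<sigma> i < \<tau> i then 1 else 0) \<le> a i" if i: "i < n" for i
  proof -
    \<comment> \<open>Column \<open>\<sigma> i\<close> is chosen so that the diagonal entry of \<open>b\<close>, a unit, appears on the right.\<close>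
    have eq: "fls_X_intpow (e i) * c $$ (\<tau> i, \<sigma> i) = b $$ (i, i) * fls_X_intpow (a i)"
      using entry[OF i \<sigma>(1)[OF i]] \<sigma>[OF i] by simp
    have "b $$ (i, i) * fls_X_intpow (a i) \<noteq> 0"
      using diag(1)[OF i] by simp
    then have nz: "c $$ (\<tau> i, \<sigma> i) \<noteq> 0"
      unfolding eq[symmetric] by (rule contrapos_nn) simp
    have "e i + fls_subdegree (c $$ (\<tau> i, \<sigma> i)) = a i"
      using arg_cong[OF eq, of fls_subdegree] nz diag(1)[OF i] by simp
    with nz
    show ?thesis
      using iwahori_entry[OF c(1) \<tau>(1)[OF i] \<sigma>(1)[OF i]] by (auto simp: vge_def)
  qed
  have le2: "a (\<sigma> (\<tau> i)) \<le> e i" if i: "i < n" for i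
  proof -
    \<comment> \<open>Column \<open>\<tau> i\<close> is chosen so that the diagonal entry of \<open>c\<close>, a unit, appears.\<close>
    have eq: "b $$ (\<sigma> (\<tau> i), i) * fls_X_intpow (a (\<tau> i)) = fls_X_intpow (e i) * c $$ (\<tau> i, \<tau> i)"
      using entry[OF i \<tau>(1)[OF i]] by simp
    have "fls_X_intpow (e i) * c $$ (\<tau> i, \<tau> i) \<noteq> 0"
      using diag(2)[OF \<tau>(1)[OF i]] by simp
    then have nz: "b $$ (\<sigma> (\<tau> i), i) \<noteq> 0"
      unfolding eq[symmetric] by (rule contrapos_nn) simp
    have "fls_subdegree (b $$ (\<sigma> (\<tau> i), i)) + a (\<tau> i) = e i"
      using arg_cong[OF eq, of fls_subdegree] nz diag(2)[OF \<tau>(1)[OF i]] by simp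
    note nz this
    moreover have "vge 0 (b $$ (\<sigma> (\<tau> i), i))"
      by (rule vge_mono[OF iwahori_entry[OF b(1) \<sigma>(1)[OF \<tau>(1)[OF i]] i]]) simp
    ultimately show ?thesis
      using \<sigma>(3)[OF \<tau>(1)[OF i]] by (simp add: vge_def)
  qed
  \<comment> \<open>The chain of inequalities consists of equalities, as its two ends have the same sum.\<close>
  have "(\<Sum>i<n. a (\<sigma> (\<tau> i))) = (\<Sum>i<n. a (\<tau> i))"
    by (intro sum.cong) (auto simp: \<sigma> \<tau>)
  also have "\<dots> = (\<Sum>i<n. a i)"
    by (rule sum.reindex_bij_betw[OF weighted_involution_permutes[OF t(1)]])
  finally have sums: "(\<Sum>i<n. a (\<sigma> (\<tau> i))) = (\<Sum>i<n. a i)" .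
  have "a (\<sigma> (\<tau> i)) \<le> a i" if "i < n" for i
    using le1[OF that] le2[OF that] by (simp split: if_splits)
  then have inv: "a (\<sigma> (\<tau> i)) = a i" if "i < n" for i
    using that by (intro sum_mono_inv[OF sums]) auto
  have ea: "e i = a i" "\<not> \<sigma> i < \<tau> i" if "i < n" for i
    using le1[OF that] le2[OF that] inv[OF that] by (auto split: if_splits)
  have "(\<Sum>i<n. \<tau> i) = (\<Sum>i<n. \<sigma> i)"
    using sum.reindex_bij_betw[OF weighted_involution_permutes[OF t(1)], of id]
      sum.reindex_bij_betw[OF weighted_involution_permutes[OF s(1)], of id] by simp
  then have "\<tau> i = \<sigma> i" if "i < n" for i
    by (rule sum_mono_inv) (use that ea in \<open>auto simp: not_less\<close>)
  then show ?thesis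
    using ea by (intro eq_matI) (auto simp: s(2) t(2) apm_def)
qed

section \<open>Gram matrices\<close>

lemma subdegree_prod_fls:
  fixes f :: "'b \<Rightarrow> 'a::field fls"
  assumes "\<And>x. x \<in> I \<Longrightarrow> f x \<noteq> 0"
  shows "fls_subdegree (\<Prod>x\<in>I. f x) = (\<Sum>x\<in>I. fls_subdegree (f x))"
  using assms by (induction I rule: infinite_finite_induct) auto

lemma det_apm:
  assumes inv: "weighted_involution n \<sigma> a"
  shows "det (apm n \<sigma> a :: 'a::field fls mat) \<noteq> 0"
    and "fls_subdegree (det (apm n \<sigma> a :: 'a fls mat)) = (\<Sum>i<n. a i)"
proof -
  let ?w = "apm n \<sigma> a :: 'a fls mat"
  define p where "p i = (if i < n then \<sigma> i else i)" for i
  have \<sigma>: "\<sigma> i < n" "\<sigma> (\<sigma> i) = i" if "i < n" for i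
    using inv that by (auto simp: weighted_involution_def)
  have p: "p permutes {0..<n}"
    by (rule bij_imp_permutes[OF bij_betw_byWitness[of _ p]]) (auto simp: p_def \<sigma>)
  have "(\<Prod>i = 0..<n. ?w $$ (i, p' i)) = 0" if p': "p' permutes {0..<n}" "p' \<noteq> p" for p'
  proof -
    obtain i where i: "p' i \<noteq> p i"
      using p'(2) by blast
    then have "i < n"
      using p'(1) p by (metis atLeastLessThan_iff not_le permutes_not_in zero_le)
    then have "?w $$ (i, p' i) = 0"
      using i permutes_in_image[OF p'(1), of i] by (simp add: apm_entry p_def)
    then show ?thesis
      using \<open>i < n\<close> by (intro prod_zero) auto
  qed
  then have "det ?w = (\<Sum>p' \<in> {p}. of_int (sign p') * (\<Prod>i = 0..<n. ?w $$ (i, p' i)))"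
    unfolding det_def'[OF apm_carrier] using p
    by (intro sum.mono_neutral_right) (auto simp: finite_permutations)
  also have "\<dots> = of_int (sign p) * (\<Prod>i = 0..<n. fls_X_intpow (a i))"
    by (simp add: apm_entry p_def \<sigma> cong: prod.cong_simp)
  finally have d: "det ?w = of_int (sign p) * (\<Prod>i = 0..<n. fls_X_intpow (a i))" .
  have nz: "(\<Prod>i = 0..<n. fls_X_intpow (a i) :: 'a fls) \<noteq> 0"
    by simp
  have s: "(of_int (sign p) :: 'a fls) \<noteq> 0" "fls_subdegree (of_int (sign p) :: 'a fls) = 0"
    by (cases p rule: sign_cases; simp)+
  show "det ?w \<noteq> 0"
    using d nz s by simp
  have "fls_subdegree (\<Prod>i = 0..<n. fls_X_intpow (a i) :: 'a fls) = (\<Sum>i = 0..<n. a i)"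
    by (subst subdegree_prod_fls) auto
  then show "fls_subdegree (det ?w) = (\<Sum>i<n. a i)"
    using d nz s by (simp add: atLeast0LessThan)
qed

lemma eSymAPM_imp_SymAPM: "w \<in> eSymAPM n \<Longrightarrow> w \<in> SymAPM n"
  by (simp add: eSymAPM_def)

lemma SymAPM_det_nonzero: "w \<in> SymAPM n \<Longrightarrow> det w \<noteq> 0"
  unfolding SymAPM_iff using det_apm(1) by blast

text \<open>The exponents add up to the valuation of \<open>det w = (det g)\<^sup>2\<close>.\<close>
lemma gram_SymAPM_imp_eSymAPM:
  assumes w: "w \<in> SymAPM n" and g: "g \<in> carrier_mat n n" and eq: "transpose_mat g * g = w"
  shows "w \<in> eSymAPM n"
proof -
  obtain \<sigma> a where s: "weighted_involution n \<sigma> a" "w = apm n \<sigma> a"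
    using w by (auto simp: SymAPM_iff)
  have d: "det w = det g * det g"
    using g by (simp add: eq[symmetric] det_mult[of _ n] det_transpose[of _ n])
  then have "det g \<noteq> 0"
    using det_apm(1)[OF s(1)] s(2) by auto
  then have "(\<Sum>i<n. a i) = 2 * fls_subdegree (det g)"
    using d det_apm(2)[OF s(1), where ?'a = 'a] s(2) by simp
  then show ?thesis
    using apm_in_eSymAPM_iff[OF s(1)] s(2) by simp
qed

lemma fixpoint_free_involution:
  assumes "finite A" "even (card A)"
  shows "\<exists>\<pi>. \<forall>x\<in>A. \<pi> x \<in> A \<and> \<pi> x \<noteq> x \<and> \<pi> (\<pi> x) = x"
  using assms
proof (induction "card A" arbitrary: A rule: less_induct)
  case less
  show ?case
  proof (cases "A = {}")
    case False
    then obtain x where x: "x \<in> A"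
      by blast
    have "A \<noteq> {x}"
      using less.prems by auto
    then obtain y where y: "y \<in> A" "y \<noteq> x"
      using x by blast
    have "card (A - {x, y}) = card A - 2" "card A \<ge> 2"
      using x y less.prems card_Diff_subset[of "{x, y}" A] card_mono[of A "{x, y}"] by auto
    then obtain \<pi> where \<pi>: "\<forall>z\<in>A - {x, y}. \<pi> z \<in> A - {x, y} \<and> \<pi> z \<noteq> z \<and> \<pi> (\<pi> z) = z"
      using less.hyps[of "A - {x, y}"] less.prems by auto
    show ?thesis
      by (rule exI[of _ "\<pi>(x := y, y := x)"]) (use \<pi> x y in auto)
  qed auto
qed

text \<open>A symmetric matrix that decomposes into blocks indexed by the orbits \<open>{k, \<tau> k}\<close> of an involution is a
  Gram matrix as soon as each block is. For an orbit with \<open>k < \<tau> k\<close>, the numbers \<open>(a, b)\<close> and \<open>(c, d)\<close> are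
  the coordinates of the \<open>k\<close>-th and the \<open>\<tau> k\<close>-th column of \<open>g\<close>.\<close>
lemma gram_matrix_of_blocks:
  fixes w :: "'f::field mat"
  assumes w: "w \<in> carrier_mat n n" "transpose_mat w = w"
    and \<tau>: "\<And>k. k < n \<Longrightarrow> \<tau> k < n" "\<And>k. k < n \<Longrightarrow> \<tau> (\<tau> k) = k"
    and off: "\<And>k l. k < n \<Longrightarrow> l < n \<Longrightarrow> l \<noteq> k \<Longrightarrow> l \<noteq> \<tau> k \<Longrightarrow> w $$ (k, l) = 0"
    and one: "\<And>k. k < n \<Longrightarrow> \<tau> k = k \<Longrightarrow> \<exists>a. a * a = w $$ (k, k)"
    and two: "\<And>k. k < n \<Longrightarrow> k < \<tau> k \<Longrightarrow> \<exists>a b c d. a * a + b * b = w $$ (k, k)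
        \<and> c * c + d * d = w $$ (\<tau> k, \<tau> k) \<and> a * c + b * d = w $$ (k, \<tau> k)"
  shows "\<exists>g \<in> carrier_mat n n. transpose_mat g * g = w"
proof -
  obtain A0 where A0: "\<And>k. k < n \<Longrightarrow> \<tau> k = k \<Longrightarrow> A0 k * A0 k = w $$ (k, k)"
    using one by metis
  obtain A B C D where ABCD: "\<And>k. k < n \<Longrightarrow> k < \<tau> k \<Longrightarrow> A k * A k + B k * B k = w $$ (k, k)
        \<and> C k * C k + D k * D k = w $$ (\<tau> k, \<tau> k) \<and> A k * C k + B k * D k = w $$ (k, \<tau> k)"
    using two by metis
  \<comment> \<open>\<open>f k r\<close> is the entry of \<open>g\<close> in row \<open>r\<close> and column \<open>k\<close>.\<close>
  define f where "f k r = (if \<tau> k = k then (if r = k then A0 k else 0)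
     else if k < \<tau> k then (if r = k then A k else if r = \<tau> k then B k else 0)
     else (if r = \<tau> k then C (\<tau> k) else if r = k then D (\<tau> k) else 0))" for k r
  define g where "g = mat n n (\<lambda>(r, k). f k r)"
  have g: "g \<in> carrier_mat n n"
    by (simp add: g_def)
  have supp: "f k r = 0" if "r \<noteq> k" "r \<noteq> \<tau> k" for k r
    using that by (simp add: f_def)
  note sym = symmetric_entry[OF w]
  have "(\<Sum>r = 0..<n. f k r * f l r) = w $$ (k, l)" if kl: "k < n" "l < n" for k l
  proof (cases "l = k \<or> l = \<tau> k")
    case False
    then have "f k r * f l r = 0" for r
      using supp[of r k] supp[of r l] \<tau>(2)[OF kl(1)] \<tau>(2)[OF kl(2)] by (metis mult_eq_0_iff)
    then have "(\<Sum>r = 0..<n. f k r * f l r) = 0"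
      by (intro sum.neutral) blast
    then show ?thesis
      using off[OF kl] False by simp
  next
    case True
    have "(\<Sum>r = 0..<n. f k r * f l r) = (\<Sum>r \<in> {k, \<tau> k}. f k r * f l r)"
      using kl \<tau>(1)[OF kl(1)] by (intro sum.mono_neutral_right) (auto simp: supp)
    also have "\<dots> = w $$ (k, l)"
    proof (cases "\<tau> k = k")
      case fixed: True
      then show ?thesis
        using True A0[OF kl(1)] by (simp add: f_def)
    next
      case moved: False
      have sum: "(\<Sum>r \<in> {k, \<tau> k}. f k r * f l r) = f k k * f l k + f k (\<tau> k) * f l (\<tau> k)"
        using moved by simp
      have \<tau>k: "\<tau> k < n" "\<tau> (\<tau> k) = k"
        using \<tau> kl(1) by auto
      show ?thesis
      proof (cases "k < \<tau> k")
        case less: True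
        then show ?thesis
          using True ABCD[OF kl(1) less] moved \<tau>k unfolding sum by (auto simp: f_def)
      next
        case False
        then have less: "\<tau> k < \<tau> (\<tau> k)"
          using moved \<tau>k by simp
        show ?thesis
          using True ABCD[OF \<tau>k(1) less] moved \<tau>k less sym[OF kl(1) \<tau>k(1)] unfolding sum
          by (auto simp: f_def algebra_simps)
      qed
    qed
    finally show ?thesis .
  qed
  then have "transpose_mat g * g = w"
    using w(1) by (intro eq_matI) (auto simp: g_def scalar_prod_def)
  then show ?thesis
    using g by blast
qed

text \<open>The off-diagonal exponents occur in pairs of equal ones, so the sum of the diagonal exponents is even.\<close>
lemma eSymAPM_odd_fixpoints:
  assumes inv: "weighted_involution n \<sigma> a" and even: "even (\<Sum>i<n. a i)"
  shows "even (card {i. i < n \<and> \<sigma> i = i \<and> odd (a i)})"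
proof -
  have \<sigma>: "\<sigma> i < n" "\<sigma> (\<sigma> i) = i" "a (\<sigma> i) = a i" if "i < n" for i
    using inv that by (auto simp: weighted_involution_def)
  define U where "U = {i. i < n \<and> i < \<sigma> i}"
  define L where "L = {i. i < n \<and> \<sigma> i < i}"
  define E where "E = {i. i < n \<and> \<sigma> i = i}"
  have fin: "finite E" "finite U" "finite L"
    by (simp_all add: U_def L_def E_def)
  have "{..<n} = E \<union> (U \<union> L)"
    by (auto simp: U_def L_def E_def)
  then have "(\<Sum>i<n. a i) = sum a (E \<union> (U \<union> L))"
    by simp
  also have "\<dots> = sum a E + sum a (U \<union> L)"
    using fin by (intro sum.union_disjoint) (auto simp: U_def L_def E_def)
  also have "sum a (U \<union> L) = sum a U + sum a L"
    using fin by (intro sum.union_disjoint) (auto simp: U_def L_def)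
  also have "sum a L = sum a U"
  proof (rule sum.reindex_bij_witness[of _ \<sigma> \<sigma>])
    fix i assume "i \<in> L"
    then show "\<sigma> (\<sigma> i) = i" "\<sigma> i \<in> U" "a (\<sigma> i) = a i"
      using \<sigma>[of i] by (simp_all add: U_def L_def)
  next
    fix i assume "i \<in> U"
    then show "\<sigma> (\<sigma> i) = i" "\<sigma> i \<in> L"
      using \<sigma>[of i] by (simp_all add: U_def L_def)
  qed
  finally have "even (sum a E)"
    using even by simp
  then have "even (card {i \<in> E. odd (a i)})"
    using even_sum_iff[OF fin(1), of a] by simp
  moreover have "{i \<in> E. odd (a i)} = {i. i < n \<and> \<sigma> i = i \<and> odd (a i)}"
    by (auto simp: E_def)
  ultimately show ?thesis
    by simp
qed

lemma eSymAPM_is_gram: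
  fixes w :: "'a::field fls mat"
  assumes qc: "quadratically_closed TYPE('a)" and w: "w \<in> eSymAPM n"
  shows "\<exists>g \<in> carrier_mat n n. transpose_mat g * g = w"
proof -
  obtain \<sigma> a where s: "weighted_involution n \<sigma> a" "w = apm n \<sigma> a"
    using eSymAPM_imp_SymAPM[OF w] unfolding SymAPM_iff by blast
  have \<sigma>: "\<sigma> i < n" "\<sigma> (\<sigma> i) = i" "a (\<sigma> i) = a i" if "i < n" for i
    using s(1) that by (simp_all add: weighted_involution_def)
  have w': "w \<in> carrier_mat n n" "transpose_mat w = w"
    using eSymAPM_imp_SymAPM[OF w] by (simp_all add: SymAPM_def)
  have entry: "w $$ (k, l) = (if l = \<sigma> k then fls_X_intpow (a k) else 0)" if "k < n" "l < n" for k l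
    using that by (simp add: s(2) apm_entry)
  have "even (\<Sum>i<n. a i)"
    using w unfolding s(2) apm_in_eSymAPM_iff[OF s(1)] .
  define Od where "Od = {i. i < n \<and> \<sigma> i = i \<and> odd (a i)}"
  have "finite Od"
    by (simp add: Od_def)
  moreover have "even (card Od)"
    unfolding Od_def by (rule eSymAPM_odd_fixpoints[OF s(1) \<open>even (\<Sum>i<n. a i)\<close>])
  ultimately have "\<exists>\<pi>. \<forall>x\<in>Od. \<pi> x \<in> Od \<and> \<pi> x \<noteq> x \<and> \<pi> (\<pi> x) = x"
    by (rule fixpoint_free_involution)
  then obtain \<pi> where \<pi>: "\<And>x. x \<in> Od \<Longrightarrow> \<pi> x \<in> Od \<and> \<pi> x \<noteq> x \<and> \<pi> (\<pi> x) = x"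
    by blast
  \<comment> \<open>The blocks are those of \<open>w\<close>, except that the odd diagonal entries are joined in pairs.\<close>
  define \<tau> where "\<tau> i = (if i \<in> Od then \<pi> i else \<sigma> i)" for i
  obtain y :: 'a where "y ^ 2 = - 1"
    using qc unfolding quadratically_closed_def by blast
  define \<iota> where "\<iota> = fls_const y"
  have \<iota>: "\<iota> * \<iota> = - 1"
    using \<open>y ^ 2 = - 1\<close> by (simp add: \<iota>_def power2_eq_square fls_const_mult_const)
  have two: "(2 :: 'a fls) \<noteq> 0"
  proof
    assume "(2 :: 'a fls) = 0"
    then have "fls_nth (1 + 1 :: 'a fls) 0 = 0"
      by simp
    then show False
      using quadratically_closed_two[OF qc] by simp
  qed
  have halves: "x / 2 + x / 2 = x" for x :: "'a fls"
    using two by (simp add: field_simps)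
  show ?thesis
  proof (rule gram_matrix_of_blocks[OF w', of \<tau>])
    fix k assume k: "k < n"
    show "\<tau> k < n"
    proof (cases "k \<in> Od")
      case True
      then have "\<pi> k \<in> Od"
        using \<pi> by blast
      then show ?thesis
        using True by (simp add: \<tau>_def) (simp add: Od_def)
    next
      case False
      then show ?thesis
        using \<sigma>(1)[OF k] by (simp add: \<tau>_def)
    qed
    show "\<tau> (\<tau> k) = k"
    proof (cases "k \<in> Od")
      case True
      then show ?thesis
        using \<pi>[of k] by (simp add: \<tau>_def)
    next
      case False
      have "\<sigma> k \<notin> Od"
      proof
        assume *: "\<sigma> k \<in> Od"
        then have "\<sigma> (\<sigma> k) = \<sigma> k"
          by (simp add: Od_def)
        then have "\<sigma> k = k"
          by (simp only: \<sigma>(2)[OF k])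
        then show False
          using * False by (simp only:)
      qed
      then show ?thesis
        using False \<sigma>[OF k] by (simp add: \<tau>_def)
    qed
    show "w $$ (k, l) = 0" if l: "l < n" "l \<noteq> k" "l \<noteq> \<tau> k" for l
    proof -
      have "l \<noteq> \<sigma> k"
        using l(2,3) by (cases "k \<in> Od") (simp_all add: \<tau>_def, simp add: Od_def)
      then show ?thesis
        by (simp add: entry[OF k l(1)])
    qed
  next
    fix k assume k: "k < n" "\<tau> k = k"
    have "k \<notin> Od"
    proof
      assume "k \<in> Od"
      then show False
        using \<pi>[of k] k(2) by (simp add: \<tau>_def)
    qed
    then have "\<sigma> k = k"
      using k(2) by (simp add: \<tau>_def)
    then have "even (a k)" "w $$ (k, k) = fls_X_intpow (a k)"
      using \<open>k \<notin> Od\<close> k(1) entry[OF k(1) k(1)] by (simp_all add: Od_def)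
    then show "\<exists>x. x * x = w $$ (k, k)"
      by (intro exI[of _ "fls_X_intpow (a k div 2)"])
        (simp only: fls_X_intpow_times_fls_X_intpow, simp only: flip: mult_2, simp only: dvd_mult_div_cancel)
  next
    fix k assume k: "k < n" "k < \<tau> k"
    define j where "j = \<tau> k"
    show "\<exists>x y z u. x * x + y * y = w $$ (k, k) \<and> z * z + u * u = w $$ (\<tau> k, \<tau> k) \<and> x * z + y * u = w $$ (k, \<tau> k)"
    proof (cases "k \<in> Od")
      case True
      then have "j = \<pi> k"
        by (simp add: j_def \<tau>_def)
      then have "j \<in> Od" "j \<noteq> k"
        using \<pi>[OF True] by simp_all
      moreover from this have "j < n"
        by (simp add: Od_def)
      ultimately have j: "j \<in> Od" "j < n" "j \<noteq> k"
        by blast+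
      have fix_pts: "\<sigma> k = k" "\<sigma> j = j"
        using True j(1) by (simp_all add: Od_def)
      define p q where "p = (fls_X_intpow (a k) :: 'a fls)" and "q = (fls_X_intpow (a j) :: 'a fls)"
      define e where "e = (fls_X_intpow ((a j - a k) div 2) :: 'a fls)"
      have "even (a j - a k)"
        using True j(1) by (auto simp: Od_def)
      then have "(a j - a k) div 2 + (a j - a k) div 2 + a k = a j"
        by presburger
      then have q: "e * e * p = q"
        unfolding e_def p_def q_def fls_X_intpow_times_fls_X_intpow by (rule arg_cong)
      have en: "w $$ (k, k) = p" "w $$ (j, j) = q" "w $$ (k, j) = 0"
        using j(2,3) k(1) fix_pts by (simp_all add: entry p_def q_def)
      \<comment> \<open>The values of \<open>x\<close> and \<open>z\<close> come from the factorisation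
        \<open>x\<^sup>2 + z\<^sup>2 = (x + \<iota> z) (x - \<iota> z) = p * 1\<close>. The second column is orthogonal to the first
        one and of the same norm, rescaled by \<open>e\<close>.\<close>
      define x where "x = (p + 1) / 2"
      define z where "z = - \<iota> * (p - 1) / 2"
      have "2 * x = p + 1" "2 * z = - \<iota> * (p - 1)"
        using two by (simp_all add: x_def z_def)
      note doubles = this
      have "2 * (2 * (x * x + z * z)) = (2 * x) * (2 * x) + (2 * z) * (2 * z)"
        by (simp add: algebra_simps)
      also have "\<dots> = (p + 1) * (p + 1) + (\<iota> * \<iota>) * ((p - 1) * (p - 1))"
        unfolding doubles by (simp add: algebra_simps)
      also have "\<dots> = 2 * (2 * p)"
        unfolding \<iota> by (simp add: algebra_simps)
      finally have "2 * (2 * (x * x + z * z)) = 2 * (2 * p)" .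
      then have xz: "x * x + z * z = p"
        using two by (simp only: mult_cancel_left) blast
      have "(- (e * z)) * (- (e * z)) + (e * x) * (e * x) = e * e * (x * x + z * z)"
        by (simp add: algebra_simps)
      then have "(- (e * z)) * (- (e * z)) + (e * x) * (e * x) = q"
        using q xz by simp
      moreover have "x * (- (e * z)) + z * (e * x) = 0"
        by (simp add: algebra_simps)
      ultimately show ?thesis
        using xz unfolding j_def[symmetric] en
        by (intro exI[of _ x] exI[of _ z] exI[of _ "- (e * z)"] exI[of _ "e * x"] conjI)
    next
      case False
      then have "j = \<sigma> k"
        by (simp add: j_def \<tau>_def)
      then have j: "\<sigma> k = j" "j < n" "j \<noteq> k" "\<sigma> j = k"
        using k(2) \<sigma>[OF k(1)] by (simp_all add: j_def[symmetric])
      define p where "p = (fls_X_intpow (a k) :: 'a fls)"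
      have en: "w $$ (k, k) = 0" "w $$ (j, j) = 0" "w $$ (k, j) = p"
        using j k(1) by (simp_all add: entry p_def)
      \<comment> \<open>The block is hyperbolic; its columns are the isotropic vectors \<open>(1, \<iota>)\<close> and
        \<open>(p / 2) (1, -\<iota>)\<close>.\<close>
      have "1 * 1 + \<iota> * \<iota> = 0"
        using \<iota> by simp
      moreover have "(p / 2) * (p / 2) + (- \<iota> * (p / 2)) * (- \<iota> * (p / 2)) = (1 + \<iota> * \<iota>) * ((p / 2) * (p / 2))"
        by (simp add: algebra_simps)
      then have "(p / 2) * (p / 2) + (- \<iota> * (p / 2)) * (- \<iota> * (p / 2)) = 0"
        using \<iota> by simp
      moreover have "1 * (p / 2) + \<iota> * (- \<iota> * (p / 2)) = p / 2 - \<iota> * \<iota> * (p / 2)"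
        by (simp add: algebra_simps)
      then have "1 * (p / 2) + \<iota> * (- \<iota> * (p / 2)) = p"
        unfolding \<iota> using halves[of p] by simp
      ultimately show ?thesis
        unfolding j_def[symmetric] en
        by (intro exI[of _ 1] exI[of _ \<iota>] exI[of _ "p / 2"] exI[of _ "- \<iota> * (p / 2)"] conjI)
    qed
  qed
qed

section \<open>Double cosets\<close>

lemma double_coset_GL_iff:
  "x \<in> K <#>\<^bsub>GL n\<^esub> {g} <#>\<^bsub>GL n\<^esub> B \<longleftrightarrow> (\<exists>k\<in>K. \<exists>b\<in>B. x = k * g * b)"
  by (auto simp: set_mult_def GL_def units_of_mult ring_mat_simps)

lemma orthogonal_groupD:
  assumes "k \<in> orthogonal_group n"
  shows "k \<in> carrier_mat n n" "transpose_mat k * k = 1\<^sub>m n"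
  using assms by (auto simp: orthogonal_group_def in_carrier_GL_iff)

text \<open>The orthogonal factor disappears, and the factor on the right acts by congruence.\<close>
lemma gram_of_double_coset_element:
  fixes g :: "'a::field fls mat"
  assumes "k \<in> orthogonal_group n" "b \<in> carrier_mat n n" "g \<in> carrier_mat n n"
  shows "transpose_mat (k * g * b) * (k * g * b) = transpose_mat b * (transpose_mat g * g) * b"
proof -
  note k = orthogonal_groupD[OF assms(1)]
  have "transpose_mat (k * g * b) * (k * g * b)
      = transpose_mat (k * (g * b)) * 1\<^sub>m n * (k * (g * b))"
    using assms k by (simp add: assoc_mult_mat[of _ n n _ n _ n])
  also have "\<dots> = transpose_mat (g * b) * (transpose_mat k * 1\<^sub>m n * k) * (g * b)"
    using assms k by (intro transpose_mult3) auto
  also have "\<dots> = transpose_mat (g * b) * 1\<^sub>m n * (g * b)"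
    using k by simp
  also have "\<dots> = transpose_mat b * (transpose_mat g * 1\<^sub>m n * g) * b"
    using assms by (intro transpose_mult3) auto
  finally show ?thesis
    using assms by simp
qed

lemma equal_gram_imp_orthogonal_translate:
  fixes g h :: "'a::field fls mat"
  assumes g: "g \<in> carrier (GL n)" and h: "h \<in> carrier (GL n)"
    and eq: "transpose_mat g * g = transpose_mat h * h"
  obtains k where "k \<in> orthogonal_group n" "h = k * g"
proof -
  obtain g' where g': "g \<in> carrier_mat n n" "g' \<in> carrier_mat n n" "g' * g = 1\<^sub>m n" "g * g' = 1\<^sub>m n"
    using g by (auto simp: in_carrier_GL_iff)
  have hc: "h \<in> carrier_mat n n"
    using h by (simp add: in_carrier_GL_iff)
  define k where "k = h * g'"
  have k: "k \<in> carrier_mat n n"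
    using hc g' by (simp add: k_def)
  have "k * g = h"
    using hc g' by (simp add: k_def assoc_mult_mat[of _ n n _ n _ n])
  have "transpose_mat k * k = transpose_mat g' * (transpose_mat h * 1\<^sub>m n * h) * g'"
    unfolding k_def using transpose_mult3[OF hc g'(2) one_carrier_mat] hc g'(2) by simp
  also have "\<dots> = transpose_mat g' * (transpose_mat g * 1\<^sub>m n * g) * g'"
    using hc g'(1) eq by simp
  also have "\<dots> = transpose_mat (g * g') * 1\<^sub>m n * (g * g')"
    using transpose_mult3[OF g'(1,2) one_carrier_mat] by simp
  finally have kk: "transpose_mat k * k = 1\<^sub>m n"
    using g' by simp
  then have "det k \<noteq> 0"
    using det_mult[of "transpose_mat k" n k] k by auto
  then have "k \<in> orthogonal_group n"
    using k kk by (simp add: orthogonal_group_def GL_field_iff)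
  then show thesis
    using that \<open>k * g = h\<close> by blast
qed

theorem theorem1p3:
  fixes n :: nat and G :: "'a::field fls mat monoid" and K B :: "'a fls mat set"
  assumes "n > 0"
    and "quadratically_closed TYPE('a)"
  defines "G \<equiv> GL n" and "K \<equiv> orthogonal_group n" and "B \<equiv> iwahori n"
  shows "(\<forall>D \<in> double_cosets G K B.
            \<exists>!w. w \<in> eSymAPM n \<and> (\<exists>g \<in> D. transpose_mat g * g = w)) \<and>
         (\<forall>w \<in> eSymAPM n.
            {g \<in> carrier G. transpose_mat g * g = w} \<noteq> {} \<and>
            (\<exists>D \<in> double_cosets G K B. {g \<in> carrier G. transpose_mat g * g = w} \<subseteq> D))"
proof (intro conjI ballI)
  note qc = \<open>quadratically_closed TYPE('a)\<close>
  have oneK: "1\<^sub>m n \<in> K"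
    by (auto simp: K_def orthogonal_group_def in_carrier_GL_iff)
  fix D assume "D \<in> double_cosets G K B"
  then obtain g where g: "g \<in> carrier G" "D = K <#>\<^bsub>G\<^esub> {g} <#>\<^bsub>G\<^esub> B"
    by (auto simp: double_cosets_def)
  have gc: "g \<in> carrier_mat n n" and det: "det g \<noteq> 0"
    using g(1) GL_field_iff[of g n] by (auto simp: G_def)
  define X where "X = transpose_mat g * g"
  have X: "X \<in> carrier_mat n n" "transpose_mat X = X" "det X \<noteq> 0"
    using gc det by (simp_all add: X_def transpose_mult[of _ n n _ n] det_mult[of _ n] det_transpose[of _ n])
  have D: "x \<in> D \<longleftrightarrow> (\<exists>k\<in>K. \<exists>b\<in>B. x = k * g * b)" for x
    using g(2) by (simp add: G_def double_coset_GL_iff)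
  have con: "iwahori_congruent n X (transpose_mat x * x)" if xD: "x \<in> D" for x
  proof -
    obtain k b where kb: "k \<in> K" "b \<in> B" "x = k * g * b"
      using xD unfolding D by blast
    have "transpose_mat x * x = transpose_mat b * X * b"
      unfolding kb(3) X_def using kb(1,2) gc
      by (intro gram_of_double_coset_element) (simp_all add: K_def B_def iwahori_carrier)
    then show ?thesis
      using X(1) kb(2) unfolding iwahori_congruent_def B_def by blast
  qed
  obtain w where w: "w \<in> SymAPM n" "iwahori_congruent n X w"
    using iwahori_congruent_SymAPM_exists[OF qc X] by blast
  obtain b where b: "b \<in> iwahori n" "w = transpose_mat b * X * b"
    using w(2) by (auto simp: iwahori_congruent_def)
  have gb: "g * b \<in> D"
    unfolding D using oneK b(1) gc iwahori_carrier[OF b(1)]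
    by (intro bexI[of _ "1\<^sub>m n"] bexI[of _ b]) (auto simp: B_def)
  have "transpose_mat (g * b) * (g * b) = w"
    using gram_of_double_coset_element[of "1\<^sub>m n" n b g] oneK gc iwahori_carrier[OF b(1)] b(2)
    by (simp add: K_def X_def)
  note gram = this
  then have wE: "w \<in> eSymAPM n"
    using gram_SymAPM_imp_eSymAPM[OF w(1), of "g * b"] gc iwahori_carrier[OF b(1)] by simp
  have uniq: "w' = w" if w': "w' \<in> eSymAPM n" "\<exists>x\<in>D. transpose_mat x * x = w'" for w'
  proof -
    obtain x where "x \<in> D" "transpose_mat x * x = w'"
      using w'(2) by blast
    then have "iwahori_congruent n X w'"
      using con by blast
    then have "iwahori_congruent n w' w"
      by (rule iwahori_congruent_trans[OF iwahori_congruent_sym w(2)])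
    then show ?thesis
      using iwahori_congruent_SymAPM_unique eSymAPM_imp_SymAPM[OF w'(1)] w(1) by blast
  qed
  show "\<exists>!w. w \<in> eSymAPM n \<and> (\<exists>g \<in> D. transpose_mat g * g = w)"
  proof (rule ex1I)
    show "w \<in> eSymAPM n \<and> (\<exists>g \<in> D. transpose_mat g * g = w)"
      using wE gram gb by blast
  qed (use uniq in blast)
next
  note qc = \<open>quadratically_closed TYPE('a)\<close>
  fix w :: "'a fls mat" assume w: "w \<in> eSymAPM n"
  obtain g where g: "g \<in> carrier_mat n n" "transpose_mat g * g = w"
    using eSymAPM_is_gram[OF qc w] by blast
  have "det w \<noteq> 0"
    by (rule SymAPM_det_nonzero[OF eSymAPM_imp_SymAPM[OF w]])
  then have "det g \<noteq> 0"
    using g det_mult[of "transpose_mat g" n g] by auto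
  then have gG: "g \<in> carrier G"
    using g(1) by (simp add: G_def GL_field_iff)
  then show "{g \<in> carrier G. transpose_mat g * g = w} \<noteq> {}"
    using g(2) by blast
  have "h \<in> K <#>\<^bsub>G\<^esub> {g} <#>\<^bsub>G\<^esub> B" if h: "h \<in> carrier G" "transpose_mat h * h = w" for h
  proof -
    obtain k where k: "k \<in> K" "h = k * g"
    proof (rule equal_gram_imp_orthogonal_translate)
      show "g \<in> carrier (GL n)" "h \<in> carrier (GL n)"
        using gG h(1) by (simp_all add: G_def)
      show "transpose_mat g * g = transpose_mat h * h"
        using g(2) h(2) by simp
    qed (simp add: K_def)
    have "h = k * g * 1\<^sub>m n"
      using k g(1) orthogonal_groupD[of k n] by (simp add: K_def)
    then show ?thesis
      using k(1) iwahori_one by (auto simp: G_def B_def double_coset_GL_iff)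
  qed
  moreover have "K <#>\<^bsub>G\<^esub> {g} <#>\<^bsub>G\<^esub> B \<in> double_cosets G K B"
    using gG unfolding double_cosets_def by blast
  ultimately show "\<exists>D \<in> double_cosets G K B. {g \<in> carrier G. transpose_mat g * g = w} \<subseteq> D"
    by blast
qed

end
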